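(* Let $m,n,r\ge 1$ be integers, let $\xi>0$ be a fixed very small positive number ($\xi\lll 1$), and let $\mathbb{H}_c$ be either $\mathbb{H}_S$ or $\mathring{\mathbb{H}}_+$. Let $\breve{\mathbf{M}}\in\mathbb{H}_c^{m\times n}$. (1) (Algorithm HNLS-WQ.) Let $\mathbf{H}\in\mathbb{R}_+^{r\times n}$ and let $(\breve{\mathbf{W}}^{(k)})_{k\ge 0}$ be the sequence of iterates generated by HNLS-WQ from an initial matrix $\breve{\mathbf{W}}^{(0)}\in\mathbb{H}_c^{m\times r}$. Then $(\breve{\mathbf{W}}^{(k)})$ converges to a stationary point of the problem $$\min_{\breve{\mathbf{W}}\in\mathbb{H}_c^{m\times r}}\ \|\breve{\mathbf{M}}-\breve{\mathbf{W}}\mathbf{H}\|_F^2 .$$ (2) (Algorithm HNLS-HR.) Let $\breve{\mathbf{W}}\in\mathbb{H}_c^{m\times r}$ and let $(\mathbf{H}^{(k)})_{k\ge 0}$ be the sequence of iterates generated by HNLS-HR from an initial matrix $\mathbf{H}^{(0)}\in\mathbb{R}_+^{r\times n}$. Then $(\mathbf{H}^{(k)})$ converges to a stationary point of the problem $$\min_{\mathbf{H}\in\mathbb{R}^{r\times n},\ \mathbf{H}\ge\xi}\ \|\breve{\mathbf{M}}-\breve{\mathbf{W}}\mathbf{H}\|_F^2,$$ where $\mathbf{H}\ge\xi$ means that every entry of $\mathbf{H}$ is at least $\xi$.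
   Context: Quaternions: $\mathbb{H}$ is the real quaternion algebra, with elements $\breve q=q_0+q_1\mathtt{i}+q_2\mathtt{j}+q_3\mathtt{k}$, $q_0,\dots,q_3\in\mathbb{R}$; $\mathrm{Re}\,\breve q=q_0$, $\mathrm{Im}\,\breve q=q_1\mathtt{i}+q_2\mathtt{j}+q_3\mathtt{k}$, $|\breve q|^2=q_0^2+q_1^2+q_2^2+q_3^2$. For a quaternion matrix, $\|\cdot\|_F^2$ is the sum of $|\cdot|^2$ over all entries, $\mathrm{Re}$ is taken entrywise, and $\breve{\mathbf{Q}}^*$ is the conjugate transpose. $\mathbb{R}_+=[0,\infty)$. $\mathbf{X}_{:,l}$ and $\mathbf{X}_{l,:}$ denote the $l$-th column and $l$-th row of $\mathbf{X}$. For a set $S$, $S^{m\times n}$ is the set of $m\times n$ matrices with all entries in $S$. Constraint sets: $\mathbb{H}_S=\{\breve q\in\mathbb{H}: \mathrm{Re}\,\breve q\ge 0,\ |\mathrm{Im}\,\breve q|^2\le(\mathrm{Re}\,\breve q)^2\}$, $\mathring{\mathbb{H}}_+=\{q_1\mathtt{i}+q_2\mathtt{j}+q_3\mathtt{k}: q_1,q_2,q_3\ge 0\}$. Projections used in the algorithms (applied entrywise to matrices and vectors): - $\mathbb{P}_{\mathbb{H}_S}$: for $\breve q=q_0+q_1\mathtt{i}+q_2\mathtt{j}+q_3\mathtt{k}$ put $\mathbf{J}=\frac12\begin{pmatrix} q_0+q_2 & q_3+\mathbf{i}q_1\\ q_3-\mathbf{i}q_1 & q_0-q_2\end{pmatrix}\in\mathbb{C}^{2\times2}$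 (here $\mathbf{i}$ is the complex imaginary unit), with eigenvalues $\eta_1,\eta_2$ and orthonormal eigenvectors $\mathbf{u}_1,\mathbf{u}_2$; write $\sum_{t=1}^2\max(0,\eta_t)\mathbf{u}_t\mathbf{u}_t^*=\begin{pmatrix} a& c\\ \bar c& b\end{pmatrix}$ and set $\mathbb{P}_{\mathbb{H}_S}(\breve q)=(a+b)+2\,\mathrm{Im}(c)\,\mathtt{i}+(a-b)\,\mathtt{j}+2\,\mathrm{Re}(c)\,\mathtt{k}$, where $\mathrm{Re}(c),\mathrm{Im}(c)$ are the real and imaginary parts of the complex number $c$. - $\mathbb{P}_{\mathring{\mathbb{H}}_+}$ (with the very small number $\xi>0$): for $\breve q=q_1\mathtt{i}+q_2\mathtt{j}+q_3\mathtt{k}$, $\mathbb{P}_{\mathring{\mathbb{H}}_+}(\breve q)=\frac12\big(\max\{\xi,|q_1|+q_1\}\mathtt{i}+\max\{\xi,|q_2|+q_2\}\mathtt{j}+\max\{\xi,|q_3|+q_3\}\mathtt{k}\big)$. Algorithm HNLS-WQ (input $\breve{\mathbf{M}},\mathbf{H},\breve{\mathbf{W}}^{(0)}$): let $\mathbf{A}=(a_{tl})=\mathbf{H}\mathbf{H}^T\in\mathbb{R}^{r\times r}$ and $\mathbf{B}=\breve{\mathbf{M}}\mathbf{H}^T$. For $k=0,1,2,\dots$ and, within each $k$, successively for $l=1,\dots,r$: $$\breve{\mathbf{W}}^{(k+1)}_{:,l}=\mathbb{P}_{\mathbb{H}_c}\!\left(\frac{\mathbf{B}_{:,l}-\sum_{t=1}^{l-1}a_{tl}\breve{\mathbf{W}}^{(k+1)}_{:,t}-\sum_{t=l+1}^{r}a_{tl}\breve{\mathbf{W}}^{(k)}_{:,t}}{a_{ll}}\right),$$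 where $\mathbb{P}_{\mathbb{H}_c}$ is $\mathbb{P}_{\mathbb{H}_S}$ or $\mathbb{P}_{\mathring{\mathbb{H}}_+}$ according to which set $\mathbb{H}_c$ is. Algorithm HNLS-HR (input $\breve{\mathbf{M}},\breve{\mathbf{W}},\mathbf{H}^{(0)}$): let $\mathbf{A}=(a_{ls})=\mathrm{Re}(\breve{\mathbf{W}}^*\breve{\mathbf{W}})\in\mathbb{R}^{r\times r}$ and $\mathbf{B}=\mathrm{Re}(\breve{\mathbf{W}}^*\breve{\mathbf{M}})\in\mathbb{R}^{r\times n}$. For $k=0,1,2,\dots$ and, within each $k$, successively for $l=1,\dots,r$: $$\mathbf{H}^{(k+1)}_{l,:}=\max\!\left(\xi,\ \frac{\mathbf{B}_{l,:}-\sum_{s=1}^{l-1}a_{ls}\mathbf{H}^{(k+1)}_{s,:}-\sum_{s=l+1}^{r}a_{ls}\mathbf{H}^{(k)}_{s,:}}{a_{ll}}\right)$$ with the maximum taken entrywise. Stationary point (usual meaning): for a problem $\min_{X\in C}f(X)$ with $C$ a closed convex subset of a finite-dimensional real Euclidean space (quaternion matrices being regarded as real vectors through their four real components) and $f$ differentiable, a point $X^\star\in C$ is stationary if $\langle\nabla f(X^\star),X-X^\star\rangle\ge 0$ for all $X\in C$.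
   Formalization: In part (1) with pure quaternions, stationarity is over matrices with imaginary components at least ξ/2 rather than at least 0; the original fails for m=n=r=1, M=0, H=1, W^(0)=0, where the iterates stay at (ξ/2)(i+j+k). A quotient with a_ll=0 is read as 0. *)

theory Defs
  imports "HOL-Analysis.Analysis"
begin

section \<open>Quaternions as a Euclidean space\<close>

datatype quat = Quat (qre: real) (qi: real) (qj: real) (qk: real)

lemma quat_eq_iff:
  "x = y \<longleftrightarrow> qre x = qre y \<and> qi x = qi y \<and> qj x = qj y \<and> qk x = qk y"
  by (cases x; cases y) auto

instantiation quat :: real_algebra_1
begin

definition "0 = Quat 0 0 0 0"
definition "1 = Quat 1 0 0 0"
definition "x + y = Quat (qre x + qre y) (qi x + qi y) (qj x + qj y) (qk x + qk y)"
definition "- x = Quat (- qre x) (- qi x) (- qj x) (- qk x)"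
definition "x - y = Quat (qre x - qre y) (qi x - qi y) (qj x - qj y) (qk x - qk y)"
definition "c *\<^sub>R x = Quat (c * qre x) (c * qi x) (c * qj x) (c * qk x)"
definition "x * y = Quat
  (qre x * qre y - qi x * qi y - qj x * qj y - qk x * qk y)
  (qre x * qi y + qi x * qre y + qj x * qk y - qk x * qj y)
  (qre x * qj y - qi x * qk y + qj x * qre y + qk x * qi y)
  (qre x * qk y + qi x * qj y - qj x * qi y + qk x * qre y)"

lemmas quat_ring_defs = zero_quat_def one_quat_def plus_quat_def uminus_quat_def
  minus_quat_def scaleR_quat_def times_quat_def

instance
  by standard (simp_all add: quat_ring_defs quat_eq_iff algebra_simps)

end

instantiation quat :: real_inner
begin

definition "x \<bullet> y = qre x * qre y + qi x * qi y + qj x * qj y + qk x * qk y"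
definition "norm x = sqrt ((qre x)\<^sup>2 + (qi x)\<^sup>2 + (qj x)\<^sup>2 + (qk x)\<^sup>2)"
definition "sgn x = x /\<^sub>R norm x" for x :: quat
definition "dist x y = norm (x - y)" for x y :: quat
definition [code del]: "(uniformity :: (quat \<times> quat) filter) =
  (INF e\<in>{0 <..}. principal {(x, y). dist x y < e})"
definition [code del]: "open (U :: quat set) \<longleftrightarrow>
  (\<forall>x\<in>U. eventually (\<lambda>(x', y). x' = x \<longrightarrow> y \<in> U) uniformity)"

instance
proof
  fix x y z :: quat and r :: real
  show "x \<bullet> y = y \<bullet> x" "(x + y) \<bullet> z = x \<bullet> z + y \<bullet> z" "(r *\<^sub>R x) \<bullet> y = r * (x \<bullet> y)"
    by (simp_all add: inner_quat_def quat_ring_defs algebra_simps)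
  show "0 \<le> x \<bullet> x"
    by (simp add: inner_quat_def)
  show "x \<bullet> x = 0 \<longleftrightarrow> x = 0"
    by (simp add: inner_quat_def quat_eq_iff zero_quat_def add_nonneg_eq_0_iff)
  show "norm x = sqrt (x \<bullet> x)"
    by (simp add: norm_quat_def inner_quat_def power2_eq_square)
qed (rule sgn_quat_def dist_quat_def uniformity_quat_def open_quat_def)+

end

instantiation quat :: euclidean_space
begin

definition "Basis = {Quat 1 0 0 0, Quat 0 1 0 0, Quat 0 0 1 0, Quat 0 0 0 1}"

instance
proof
  fix u v x :: quat
  show "(Basis :: quat set) \<noteq> {}" "finite (Basis :: quat set)"
    by (simp_all add: Basis_quat_def)
  show "u \<bullet> v = (if u = v then 1 else 0)" if "u \<in> Basis" "v \<in> Basis"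
    using that unfolding Basis_quat_def
    by (elim insertE emptyE) (simp_all add: inner_quat_def)
  show "(\<forall>u\<in>Basis. x \<bullet> u = 0) \<longleftrightarrow> x = 0"
    by (cases x) (simp add: Basis_quat_def inner_quat_def zero_quat_def)
qed

end

definition qcnj :: "quat \<Rightarrow> quat" where
  "qcnj q = Quat (qre q) (- qi q) (- qj q) (- qk q)"

definition qIm :: "quat \<Rightarrow> quat" where
  "qIm q = Quat 0 (qi q) (qj q) (qk q)"


section \<open>Matrices\<close>

definition qmat_of_real :: "real^'n^'m \<Rightarrow> quat^'n^'m" where
  "qmat_of_real A = (\<chi> i j. of_real (A $ i $ j))"

definition qmat_Re :: "quat^'n^'m \<Rightarrow> real^'n^'m" where
  "qmat_Re Q = (\<chi> i j. qre (Q $ i $ j))"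

definition qmat_adjoint :: "quat^'n^'m \<Rightarrow> quat^'m^'n" where
  "qmat_adjoint Q = (\<chi> i j. qcnj (Q $ j $ i))"

definition frobenius_sq :: "quat^'n^'m \<Rightarrow> real" where
  "frobenius_sq Q = (\<Sum>i\<in>UNIV. \<Sum>j\<in>UNIV. (norm (Q $ i $ j))\<^sup>2)"

definition mats_over :: "'a set \<Rightarrow> ('a^'n^'m) set" where
  "mats_over S = {X. \<forall>i j. X $ i $ j \<in> S}"


section \<open>Constraint sets and the maps used by the algorithms\<close>

definition H_S :: "quat set" where
  "H_S = {q. qre q \<ge> 0 \<and> (norm (qIm q))\<^sup>2 \<le> (qre q)\<^sup>2}"

definition H_pure :: "quat set" where
  "H_pure = {q. qre q = 0 \<and> qi q \<ge> 0 \<and> qj q \<ge> 0 \<and> qk q \<ge> 0}"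

(* The map proj_pure below never returns a component smaller than \<xi>/2: it is the metric
   projection onto this set, not onto H_pure.  With M = 0 and H = 1 (all matrices 1x1) its
   iterates are constantly Quat 0 (\<xi>/2) (\<xi>/2) (\<xi>/2), which is not stationary over H_pure,
   so stationarity of its limits is stated over this set. *)
definition H_pure_floor :: "real \<Rightarrow> quat set" where
  "H_pure_floor \<xi> = {q. qre q = 0 \<and> qi q \<ge> \<xi> / 2 \<and> qj q \<ge> \<xi> / 2 \<and> qk q \<ge> \<xi> / 2}"

definition proj_pure :: "real \<Rightarrow> quat \<Rightarrow> quat" where
  "proj_pure \<xi> q = (1/2) *\<^sub>R
     Quat 0 (max \<xi> (\<bar>qi q\<bar> + qi q)) (max \<xi> (\<bar>qj q\<bar> + qj q)) (max \<xi> (\<bar>qk q\<bar> + qk q))"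

definition J_of :: "quat \<Rightarrow> complex^2^2" where
  "J_of q = vector
     [vector [of_real ((qre q + qj q) / 2), Complex (qk q / 2) (qi q / 2)],
      vector [Complex (qk q / 2) (- (qi q / 2)), of_real ((qre q - qj q) / 2)]]"

definition orthonormal_eigensystem ::
  "complex^2^2 \<Rightarrow> (2 \<Rightarrow> real) \<Rightarrow> (2 \<Rightarrow> complex^2) \<Rightarrow> bool" where
  "orthonormal_eigensystem J \<eta> u \<longleftrightarrow>
     (\<forall>s t. (\<Sum>i\<in>UNIV. cnj (u s $ i) * u t $ i) = (if s = t then 1 else 0)) \<and>
     (\<forall>t. J *v u t = of_real (\<eta> t) *s u t)"

(* Any choice of the eigensystem gives the same matrix. *)
definition psd_part :: "complex^2^2 \<Rightarrow> complex^2^2" where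
  "psd_part J = (SOME P. \<exists>\<eta> u. orthonormal_eigensystem J \<eta> u \<and>
     P = (\<Sum>t\<in>UNIV. \<chi> i j. of_real (max 0 (\<eta> t)) * (u t $ i * cnj (u t $ j))))"

definition proj_S :: "quat \<Rightarrow> quat" where
  "proj_S q = (let P = psd_part (J_of q); a = Re (P $ 1 $ 1); b = Re (P $ 2 $ 2); c = P $ 1 $ 2
     in Quat (a + b) (2 * Im c) (a - b) (2 * Re c))"


section \<open>The algorithms\<close>

(* Column and row indices range over an arbitrary finite linear order 'r in place of 1,...,r.
   If a_ll = 0 the quotient is 0 by the convention inverse 0 = 0. *)

definition HNLS_WQ_iterates ::
  "(quat \<Rightarrow> quat) \<Rightarrow> quat^'n^'m \<Rightarrow> real^'n^'r::{finite,linorder} \<Rightarrow> (nat \<Rightarrow> quat^'r::{finite,linorder}^'m) \<Rightarrow> bool" where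
  "HNLS_WQ_iterates P M H W \<longleftrightarrow>
     (let A = H ** transpose H; B = M ** qmat_of_real (transpose H) in
      \<forall>k l i. W (Suc k) $ i $ l =
        P ((B $ i $ l - (\<Sum>t | t < l. (A $ t $ l) *\<^sub>R (W (Suc k) $ i $ t))
                      - (\<Sum>t | l < t. (A $ t $ l) *\<^sub>R (W k $ i $ t))) /\<^sub>R (A $ l $ l)))"

definition HNLS_HR_iterates ::
  "real \<Rightarrow> quat^'n^'m \<Rightarrow> quat^'r::{finite,linorder}^'m \<Rightarrow> (nat \<Rightarrow> real^'n^'r::{finite,linorder}) \<Rightarrow> bool" where
  "HNLS_HR_iterates \<xi> M W H \<longleftrightarrow>
     (let A = qmat_Re (qmat_adjoint W ** W); B = qmat_Re (qmat_adjoint W ** M) in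
      \<forall>k l j. H (Suc k) $ l $ j =
        max \<xi> ((B $ l $ j - (\<Sum>s | s < l. A $ l $ s * H (Suc k) $ s $ j)
                          - (\<Sum>s | l < s. A $ l $ s * H k $ s $ j)) / A $ l $ l))"


section \<open>Stationary points\<close>

definition stationary_point :: "('a::euclidean_space \<Rightarrow> real) \<Rightarrow> 'a set \<Rightarrow> 'a \<Rightarrow> bool" where
  "stationary_point f C x \<longleftrightarrow>
     x \<in> C \<and> (\<exists>g. GDERIV f x :> g \<and> (\<forall>y\<in>C. g \<bullet> (y - x) \<ge> 0))"

end

theory Submission
  imports Defs
begin

text \<open>Rows of \<open>W\<close> (respectively columns of \<open>H\<close>) decouple, and on each of them the algorithm is
  exact cyclic block minimisation of a convex quadratic \<open>f\<close> over a product of translated cones.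
  A sweep with step \<open>\<delta>\<close> decreases \<open>f\<close> by a multiple of \<open>|\<delta>|^2\<close>, and the variational inequality
  at its end point fails by at most a multiple of \<open>|\<delta>|\<close>; the iterates are bounded because the Gram
  matrix has nonnegative entries and the cones are contained in their duals. Hence every limit point
  is stationary. Since the Gram matrix may be singular, minimisers need not be unique, and convergence
  of the whole sequence is obtained from finite length: the set of minimisers is a linear slice of
  the cone, facial reduction bounds the distance to it by a power of the optimality gap, and this
  error bound yields a Kurdyka--Lojasiewicz inequality.\<close>

section \<open>Hoelder error bounds for linear slices of cones\<close>

text \<open>For polyhedral sets Hoffman's bound is linear in the residual. \<open>H_S\<close> is
  round: where a slice touches it tangentially, the distance to the slice can grow like the square
  root of the residual. Each facial reduction is therefore allowed one square root, and the final
  exponent N depends on how many reductions are made. The summability argument tolerates every N,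
  because the residual is at most a multiple of the square root of the optimality gap and the
  exponent 1/(2N) is still positive. Two details shape the iteration part. A zero diagonal entry of
  the Gram matrix makes the update divide by zero; such a block is frozen from the first sweep on,
  and its gradient component vanishes. The maps of the algorithms enter only through two properties:
  their values lie in the constraint set, and the obtuse-angle inequality of a metric projection
  holds. For \<open>proj_S\<close> this is drawn from the spectral decomposition of a 2 by 2
  Hermitian matrix.\<close>

text \<open>The square in the distance estimate is what curved cones allow; polyhedral cones satisfy it
  a fortiori on bounded sets. Closure of the family under exposed faces makes facial reduction
  possible.\<close>

definition facially_regular :: "'a::euclidean_space set set \<Rightarrow> bool" where
  "facially_regular \<F> \<longleftrightarrow> (\<forall>F\<in>\<F>. convex F \<and> cone F \<and> 0 \<in> F \<and>
     (\<forall>z. (\<forall>x\<in>F. 0 \<le> z \<bullet> x) \<longrightarrow>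
        F \<inter> {x. z \<bullet> x = 0} \<in> \<F> \<and>
        (\<forall>R. \<exists>C\<ge>0. \<forall>x\<in>F. norm x \<le> R \<longrightarrow>
           (\<exists>x'\<in>F. z \<bullet> x' = 0 \<and> (norm (x - x'))\<^sup>2 \<le> C * (z \<bullet> x)))))"

lemma facially_regularD:
  assumes "facially_regular \<F>" "F \<in> \<F>"
  shows "convex F" "cone F" "0 \<in> F"
    and "\<And>z. (\<And>x. x \<in> F \<Longrightarrow> 0 \<le> z \<bullet> x) \<Longrightarrow> F \<inter> {x. z \<bullet> x = 0} \<in> \<F>"
    and "\<And>z R. (\<And>x. x \<in> F \<Longrightarrow> 0 \<le> z \<bullet> x) \<Longrightarrow> \<exists>C\<ge>0. \<forall>x\<in>F. norm x \<le> R \<longrightarrow>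
           (\<exists>x'\<in>F. z \<bullet> x' = 0 \<and> (norm (x - x'))\<^sup>2 \<le> C * (z \<bullet> x))"
  using bspec[OF assms(1)[unfolded facially_regular_def] assms(2)] by simp_all

lemma norm_triangle_power:
  fixes a b :: "'a::real_normed_vector"
  shows "norm (a + b) ^ n \<le> 2 ^ n * (norm a ^ n + norm b ^ n)"
proof -
  have "norm (a + b) \<le> 2 * max (norm a) (norm b)"
    using norm_triangle_ineq[of a b] by linarith
  then have "norm (a + b) ^ n \<le> (2 * max (norm a) (norm b)) ^ n"
    by (intro power_mono) auto
  also have "\<dots> \<le> 2 ^ n * (norm a ^ n + norm b ^ n)"
    by (auto simp: power_mult_distrib max_def)
  finally show ?thesis .
qed

text \<open>A linear right inverse of \<open>T\<close> on the image of \<open>V\<close>, with values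
  in \<open>V\<close>, is bounded in finite dimensions; \<open>B\<close> is its bound.\<close>

lemma linear_lift_on_subspace:
  fixes T :: "'a::euclidean_space \<Rightarrow> 'b::euclidean_space"
  assumes "linear T" "subspace V"
  obtains B where "B > 0"
    and "\<And>u. u \<in> V \<Longrightarrow> \<exists>v\<in>V. T v = T u \<and> norm v \<le> B * norm (T u)"
proof -
  obtain g where g: "range g \<subseteq> V" "linear g" "\<And>v. v \<in> T ` V \<Longrightarrow> T (g v) = v"
    using linear_exists_right_inverse_on[OF assms(1)] assms(2) by blast
  obtain B where "B > 0" "\<And>x. norm (g x) \<le> B * norm x"
    using linear_bounded_pos[OF g(2)] by blast
  with g that[of B] show ?thesis by blast
qed

text \<open>Slater case: the slice meets the relative interior, so there is room around
  \<open>y\<close> inside \<open>span F\<close> to absorb the correction of the residual, and no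
  root is lost.\<close>

lemma lipschitz_slice:
  fixes T :: "'a::euclidean_space \<Rightarrow> 'b::euclidean_space"
  assumes T: "linear T" and F: "convex F" "0 \<in> F" and y: "y \<in> rel_interior F"
  shows "\<exists>C\<ge>0. \<forall>x\<in>F. norm x \<le> R \<longrightarrow>
    (\<exists>x'\<in>F. T x' = T y \<and> norm (x - x') \<le> C * norm (T x - T y))"
proof -
  obtain \<rho> where \<rho>: "\<rho> > 0" "ball y \<rho> \<inter> span F \<subseteq> F" and yF: "y \<in> F"
    using y F(2) by (auto simp: mem_rel_interior_ball affine_hull_span_0 hull_inc)
  obtain B where B: "B > 0"
    "\<And>u. u \<in> span F \<Longrightarrow> \<exists>v\<in>span F. T v = T u \<and> norm v \<le> B * norm (T u)"
    using linear_lift_on_subspace[OF T subspace_span] by metis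
  \<comment> \<open>The first summand pays for the correction \<open>v\<close>, the second for the
    pull of \<open>x\<close> towards \<open>y\<close>, whose weight is at most
    \<open>2 * B * \<epsilon> / \<rho>\<close>.\<close>
  define C where "C = B + B * 2 / \<rho> * (\<bar>R\<bar> + norm y)"
  have "C \<ge> 0" using B \<rho> by (simp add: C_def)
  moreover have "\<exists>x'\<in>F. T x' = T y \<and> norm (x - x') \<le> C * norm (T x - T y)"
    if x: "x \<in> F" "norm x \<le> R" for x
  proof (cases "T x = T y")
    case True
    then show ?thesis using x by auto
  next
    case False
    define \<epsilon> where "\<epsilon> = norm (T x - T y)"
    have \<epsilon>: "\<epsilon> > 0" using False by (simp add: \<epsilon>_def)
    have "x - y \<in> span F" using x yF by (simp add: span_diff span_base)
    then obtain v where v: "v \<in> span F" "T v = T x - T y" "norm v \<le> B * \<epsilon>"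
      using B(2)[of "x - y"] by (auto simp: linear_diff[OF T] \<epsilon>_def)
    \<comment> \<open>The corrected point \<open>x - v\<close> may leave \<open>F\<close>; pulling it towards \<open>y\<close> with weight \<open>l\<close> moves it back.\<close>
    define l where "l = 2 * B * \<epsilon> / (\<rho> + 2 * B * \<epsilon>)"
    have den: "\<rho> + 2 * B * \<epsilon> > 0" using \<rho> B \<epsilon> by (simp add: add_pos_pos)
    have l: "0 < l" "l < 1" using \<rho> B \<epsilon> den by (simp_all add: l_def)
    \<comment> \<open>This ratio makes the displacement of \<open>c\<close> from \<open>y\<close> at
      most half of \<open>\<rho>\<close>.\<close>
    have lr: "(1 - l) / l = \<rho> / (2 * B * \<epsilon>)"
    proof -
      have "1 - l = \<rho> / (\<rho> + 2 * B * \<epsilon>)"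
        using den by (simp add: l_def diff_divide_eq_iff)
      then show ?thesis using den by (simp add: l_def)
    qed
    define c where "c = y - ((1 - l) / l) *\<^sub>R v"
    have "norm (((1 - l) / l) *\<^sub>R v) = \<rho> / (2 * B * \<epsilon>) * norm v"
      using \<rho> B \<epsilon> by (simp add: lr)
    also have "\<dots> \<le> \<rho> / (2 * B * \<epsilon>) * (B * \<epsilon>)"
      using v \<rho> B \<epsilon> by (intro mult_left_mono) auto
    also have "\<dots> < \<rho>" using \<rho> B \<epsilon> by simp
    finally have "c \<in> ball y \<rho>" by (simp add: c_def dist_norm)
    moreover have "c \<in> span F"
      using v yF by (simp add: c_def span_diff span_base span_scale)
    ultimately have cF: "c \<in> F" using \<rho> by blast
    define x' where "x' = (1 - l) *\<^sub>R x + l *\<^sub>R c"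
    have "x' \<in> F" unfolding x'_def using l by (intro convexD_alt[OF F(1) x(1) cF]) auto
    \<comment> \<open>The defining form shows \<open>x' \<in> F\<close>; this one shows
      \<open>T x' = T y\<close>, because \<open>T (x - v) = T y\<close>.\<close>
    have x'_alt: "x' = (1 - l) *\<^sub>R (x - v) + l *\<^sub>R y"
    proof -
      have "l *\<^sub>R c = l *\<^sub>R y - (1 - l) *\<^sub>R v"
        using l by (simp add: c_def scaleR_diff_right)
      then show ?thesis by (simp add: x'_def scaleR_diff_right)
    qed
    have "T x' = T y"
      by (simp add: x'_alt linear_add[OF T] linear_diff[OF T] linear_scale[OF T] v(2) flip: scaleR_add_left)
    have "x - x' = (1 - l) *\<^sub>R v + l *\<^sub>R (x - y)"
      by (simp add: x'_alt scaleR_diff_left scaleR_diff_right)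
    then have "norm (x - x') \<le> (1 - l) * norm v + l * norm (x - y)"
      using norm_triangle_ineq[of "(1 - l) *\<^sub>R v" "l *\<^sub>R (x - y)"] l by simp
    also have "\<dots> \<le> B * \<epsilon> + 2 * B * \<epsilon> / \<rho> * (\<bar>R\<bar> + norm y)"
    proof (rule add_mono[OF _ mult_mono])
      show "(1 - l) * norm v \<le> B * \<epsilon>"
        using v(3) l mult_left_le_one_le[of "norm v" "1 - l"] by auto
      show "l \<le> 2 * B * \<epsilon> / \<rho>"
        unfolding l_def using \<rho> B \<epsilon> den by (intro divide_left_mono) auto
      show "norm (x - y) \<le> \<bar>R\<bar> + norm y"
        using norm_triangle_ineq4[of x y] x by linarith
    qed (use \<rho> B \<epsilon> in auto)
    also have "\<dots> = C * \<epsilon>" by (simp add: C_def field_simps)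
    finally show ?thesis using \<open>x' \<in> F\<close> \<open>T x' = T y\<close> unfolding \<epsilon>_def by blast
  qed
  ultimately show ?thesis by blast
qed

text \<open>Facial reduction: if the slice misses the relative interior of \<open>F\<close>, a separating hyperplane
  exposes a face of smaller dimension containing the slice, at the price of doubling the exponent.\<close>

lemma holder_slice:
  fixes T :: "'a::euclidean_space \<Rightarrow> 'b::euclidean_space"
  assumes T: "linear T" and fam: "facially_regular \<F>" and "F \<in> \<F>" "y \<in> F"
  shows "\<exists>N>0. \<forall>R. \<exists>C\<ge>0. \<forall>x\<in>F. norm x \<le> R \<longrightarrow>
    (\<exists>x'\<in>F. T x' = T y \<and> norm (x - x') ^ N \<le> C * norm (T x - T y))"
  using assms(3,4)
proof (induction "dim F" arbitrary: F rule: less_induct)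
  case less
  note F = facially_regularD[OF fam \<open>F \<in> \<F>\<close>]
  show ?case
  \<comment> \<open>The test is made in the image: any \<open>y'\<close> of the relative interior
    with the same image as \<open>y\<close> defines the same slice.\<close>
  proof (cases "T y \<in> rel_interior (T ` F)")
    case True
    then obtain y' where "y' \<in> rel_interior F" "T y' = T y"
      using rel_interior_convex_linear_image[OF T F(1)] by (metis imageE)
    then show ?thesis
      using lipschitz_slice[OF T F(1) F(3)] by (intro exI[of _ 1]) (metis power_one_right zero_less_one)
  next
    case False
    have "convex (T ` F)" using F(1) T by (simp add: convex_linear_image)
    then obtain w where w: "\<And>x. x \<in> F \<Longrightarrow> w \<bullet> T y \<le> w \<bullet> T x"
        "\<And>u. u \<in> rel_interior (T ` F) \<Longrightarrow> w \<bullet> T y < w \<bullet> u"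
      using supporting_hyperplane_rel_boundary[OF _ _ False] \<open>y \<in> F\<close> by (metis imageI)
    \<comment> \<open>Pulled back through \<open>T\<close>, the separating functional is controlled
      by the residual: \<open>z \<bullet> x = w \<bullet> (T x - T y)\<close> once
      \<open>z \<bullet> y = 0\<close>.\<close>
    define z where "z = adjoint T w"
    have z: "z \<bullet> x = w \<bullet> T x" for x
      using adjoint_works[OF T, of x w] by (simp add: z_def inner_commute)
    have zy: "z \<bullet> y = 0"
    proof -
      have "2 *\<^sub>R y \<in> F" using F(2) \<open>y \<in> F\<close> by (simp add: cone_def)
      from w(1)[OF this] w(1)[OF F(3)] show ?thesis
        by (simp add: z linear_scale[OF T] linear_0[OF T])
    qed
    have pos: "0 \<le> z \<bullet> x" if "x \<in> F" for x
      using w(1)[OF that] zy by (simp add: z)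
    define G where "G = F \<inter> {x. z \<bullet> x = 0}"
    have G: "G \<in> \<F>" using F(4)[OF pos] by (simp add: G_def)
    have yG: "y \<in> G" using \<open>y \<in> F\<close> zy by (simp add: G_def)
    \<comment> \<open>Strict separation on the relative interior keeps \<open>p\<close> out of
      \<open>span G\<close>, which makes the dimension drop.\<close>
    obtain p where p: "p \<in> rel_interior F"
      using F(1,3) rel_interior_eq_empty by blast
    then have pF: "p \<in> F" using rel_interior_subset by blast
    have "T p \<in> rel_interior (T ` F)"
      using p rel_interior_convex_linear_image[OF T F(1)] by blast
    then have "z \<bullet> p > 0" using w(2)[of "T p"] zy by (simp add: z)
    have "span G \<subseteq> {x. z \<bullet> x = 0}"
      by (intro span_minimal subspace_hyperplane) (auto simp: G_def)
    then have "p \<notin> span G" using \<open>z \<bullet> p > 0\<close> by auto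
    moreover have "span G \<subseteq> span F" by (intro span_mono) (auto simp: G_def)
    ultimately have "dim G < dim F"
      using pF by (intro dim_psubset) (auto simp: span_base)
    from less.hyps[OF this G yG] obtain N where N: "N > 0"
      and IH: "\<And>R. \<exists>C\<ge>0. \<forall>x\<in>G. norm x \<le> R \<longrightarrow>
        (\<exists>x'\<in>G. T x' = T y \<and> norm (x - x') ^ N \<le> C * norm (T x - T y))"
      by blast
    obtain B where B: "B > 0" "\<And>x. norm (T x) \<le> B * norm x"
      using linear_bounded_pos[OF T] by blast
    show ?thesis
    \<comment> \<open>Reaching the face costs a square root of the residual, and the induction
      hypothesis then starts from a residual of that size; hence \<open>2 * N\<close>.\<close>
    proof (intro exI[of _ "2 * N"] conjI allI)
      show "0 < 2 * N" using N by simp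
      fix R
      obtain C1 where C1: "C1 \<ge> 0" "\<And>x. x \<in> F \<Longrightarrow> norm x \<le> R \<Longrightarrow>
           \<exists>x'\<in>F. z \<bullet> x' = 0 \<and> (norm (x - x'))\<^sup>2 \<le> C1 * (z \<bullet> x)"
        using F(5)[OF pos] by meson
      \<comment> \<open>A bound for the residual on the ball of radius \<open>R\<close>; it absorbs
        surplus powers of \<open>\<epsilon>\<close>, so that only the first power remains.\<close>
      define E where "E = B * \<bar>R\<bar> + norm (T y)"
      define C3 where "C3 = C1 * norm w"
      have E0: "E \<ge> 0" and C30: "C3 \<ge> 0" using B C1 by (simp_all add: E_def C3_def)
      \<comment> \<open>The point \<open>x1\<close> on the face may be longer than \<open>x\<close>,
        so the radius is enlarged by a bound on the displacement.\<close>
      obtain C2 where C2: "C2 \<ge> 0" "\<And>x. x \<in> G \<Longrightarrow> norm x \<le> R + sqrt (C3 * E) \<Longrightarrow>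
           \<exists>x'\<in>G. T x' = T y \<and> norm (x - x') ^ N \<le> C2 * norm (T x - T y)"
        using IH by meson
      define C where "C = 2 ^ (2 * N) * (C3 ^ N * E ^ (N - 1) + C2\<^sup>2 * (2 * E + 2 * B\<^sup>2 * C3))"
      have "C \<ge> 0" using E0 C30 C2 by (simp add: C_def)
      moreover have "\<exists>x'\<in>F. T x' = T y \<and> norm (x - x') ^ (2 * N) \<le> C * norm (T x - T y)"
        if x: "x \<in> F" "norm x \<le> R" for x
      proof -
        define \<epsilon> where "\<epsilon> = norm (T x - T y)"
        have \<epsilon>0: "\<epsilon> \<ge> 0" by (simp add: \<epsilon>_def)
        have "norm (T x) \<le> B * \<bar>R\<bar>"
          using B(2)[of x] x(2) B(1) by (smt (verit) mult_left_mono)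
        then have \<epsilon>E: "\<epsilon> \<le> E"
          unfolding \<epsilon>_def E_def using norm_triangle_ineq4[of "T x" "T y"] by linarith
        have "z \<bullet> x = w \<bullet> (T x - T y)" using zy by (simp add: z inner_diff_right)
        also have "\<dots> \<le> norm w * \<epsilon>" unfolding \<epsilon>_def by (rule norm_cauchy_schwarz)
        finally have zx: "z \<bullet> x \<le> norm w * \<epsilon>" .
        obtain x1 where x1: "x1 \<in> F" "z \<bullet> x1 = 0" "(norm (x - x1))\<^sup>2 \<le> C1 * (z \<bullet> x)"
          using C1(2)[OF x] by blast
        have d1: "(norm (x - x1))\<^sup>2 \<le> C3 * \<epsilon>"
          using x1(3) mult_left_mono[OF zx C1(1)] by (simp add: C3_def mult.assoc)
        also have "\<dots> \<le> C3 * E" using \<epsilon>E C30 by (rule mult_left_mono)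
        finally have "norm (x - x1) \<le> sqrt (C3 * E)" by (rule real_le_rsqrt)
        then have "norm x1 \<le> R + sqrt (C3 * E)"
          using norm_triangle_ineq2[of x1 x] x(2) by (simp add: norm_minus_commute)
        moreover have "x1 \<in> G" using x1 by (simp add: G_def)
        ultimately obtain x2 where x2: "x2 \<in> G" "T x2 = T y"
            "norm (x1 - x2) ^ N \<le> C2 * norm (T x1 - T y)"
          using C2(2) by blast
        have "norm (T x1 - T y) \<le> \<epsilon> + B * norm (x - x1)"
        proof -
          have "T x1 - T y = (T x - T y) - T (x - x1)" by (simp add: linear_diff[OF T])
          then have "norm (T x1 - T y) \<le> norm (T x - T y) + norm (T (x - x1))"
            by (simp only: norm_triangle_ineq4)
          then show ?thesis
            using B(2)[of "x - x1"] unfolding \<epsilon>_def by linarith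
        qed
        then have "(norm (T x1 - T y))\<^sup>2 \<le> (\<epsilon> + B * norm (x - x1))\<^sup>2"
          by (intro power_mono) auto
        also have "\<dots> \<le> 2 * \<epsilon>\<^sup>2 + 2 * (B * norm (x - x1))\<^sup>2"
          using sum_squares_bound[of \<epsilon> "B * norm (x - x1)"] by (simp add: power2_sum)
        also have "\<dots> \<le> 2 * (E * \<epsilon>) + 2 * (B\<^sup>2 * (C3 * \<epsilon>))"
        proof -
          have "\<epsilon>\<^sup>2 \<le> E * \<epsilon>"
            using \<epsilon>E \<epsilon>0 by (simp add: power2_eq_square mult_right_mono)
          moreover have "(B * norm (x - x1))\<^sup>2 \<le> B\<^sup>2 * (C3 * \<epsilon>)"
            unfolding power_mult_distrib by (rule mult_left_mono[OF d1]) simp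
          ultimately show ?thesis by linarith
        qed
        finally have t1: "(norm (T x1 - T y))\<^sup>2 \<le> (2 * E + 2 * B\<^sup>2 * C3) * \<epsilon>"
          by (simp add: algebra_simps)
        have "(norm (x1 - x2) ^ N)\<^sup>2 \<le> (C2 * norm (T x1 - T y))\<^sup>2"
          using x2(3) by (intro power_mono) auto
        also have "\<dots> \<le> C2\<^sup>2 * ((2 * E + 2 * B\<^sup>2 * C3) * \<epsilon>)"
          unfolding power_mult_distrib by (rule mult_left_mono[OF t1]) simp
        finally have e2: "norm (x1 - x2) ^ (2 * N) \<le> C2\<^sup>2 * (2 * E + 2 * B\<^sup>2 * C3) * \<epsilon>"
          by (simp add: power_mult mult.commute[of 2 N] mult.assoc)
        have "norm (x - x1) ^ (2 * N) \<le> (C3 * \<epsilon>) ^ N"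
          unfolding power_mult by (intro power_mono d1) auto
        also have "\<dots> = C3 ^ N * (\<epsilon> ^ (N - 1) * \<epsilon>)"
          by (simp only: power_mult_distrib power_minus_mult[OF N])
        also have "\<dots> \<le> C3 ^ N * (E ^ (N - 1) * \<epsilon>)"
          using \<epsilon>0 \<epsilon>E C30 by (intro mult_left_mono mult_right_mono power_mono zero_le_power order_refl) assumption+
        finally have e1: "norm (x - x1) ^ (2 * N) \<le> C3 ^ N * E ^ (N - 1) * \<epsilon>"
          by (simp add: mult.assoc)
        have "norm (x - x2) ^ (2 * N) \<le> 2 ^ (2 * N) *
            (norm (x - x1) ^ (2 * N) + norm (x1 - x2) ^ (2 * N))"
          using norm_triangle_power[of "x - x1" "x1 - x2" "2 * N"] by (simp only: diff_add_cancel add_diff_eq)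
        also have "\<dots> \<le> 2 ^ (2 * N) * (C3 ^ N * E ^ (N - 1) * \<epsilon> + C2\<^sup>2 * (2 * E + 2 * B\<^sup>2 * C3) * \<epsilon>)"
          using e1 e2 by (intro mult_left_mono add_mono) auto
        also have "\<dots> = C * \<epsilon>" unfolding C_def by (simp only: distrib_right mult.assoc)
        finally have "norm (x - x2) ^ (2 * N) \<le> C * norm (T x - T y)" by (simp only: \<epsilon>_def)
        moreover have "x2 \<in> F" using x2(1) by (simp add: G_def)
        ultimately show ?thesis using x2(2) by blast
      qed
      ultimately show "\<exists>C\<ge>0. \<forall>x\<in>F. norm x \<le> R \<longrightarrow>
          (\<exists>x'\<in>F. T x' = T y \<and> norm (x - x') ^ (2 * N) \<le> C * norm (T x - T y))"
        by blast
    qed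
  qed
qed

section \<open>Facially regular families: products, orthants, second-order cones\<close>

lemma facially_regular_product:
  assumes fam: "facially_regular (\<F> :: 'a::euclidean_space set set)"
  shows "facially_regular {{x :: 'a^'r. \<forall>l. x $ l \<in> Fs l} | Fs. \<forall>l. Fs l \<in> \<F>}"
  unfolding facially_regular_def
proof (clarify, intro conjI allI impI)
  fix Fs :: "'r \<Rightarrow> 'a set"
  assume Fs: "\<forall>l. Fs l \<in> \<F>"
  note F = facially_regularD[OF fam Fs[rule_format]]
  let ?P = "{x :: 'a^'r. \<forall>l. x $ l \<in> Fs l}"
  show "convex ?P"
    using F(1) unfolding convex_def by (auto simp: Ball_def)
  show "cone ?P" using F(2) by (auto simp: cone_def)
  show "0 \<in> ?P" using F(3) by simp
  fix z :: "'a^'r"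
  assume z: "\<forall>x\<in>?P. 0 \<le> z \<bullet> x"
  \<comment> \<open>A vector supported on a single index isolates one component, so an exposed face
    of the product is a product of exposed faces.\<close>
  have zl: "0 \<le> z $ l \<bullet> u" if "u \<in> Fs l" for l u
  proof -
    have "axis l u \<in> ?P" using that F(3) by (auto simp: axis_def)
    with z show ?thesis by (auto simp: inner_axis)
  qed
  have "?P \<inter> {x. z \<bullet> x = 0} = {x. \<forall>l. x $ l \<in> Fs l \<inter> {u. z $ l \<bullet> u = 0}}"
    using zl by (auto simp: inner_vec_def sum_nonneg_eq_0_iff)
  moreover have "Fs l \<inter> {u. z $ l \<bullet> u = 0} \<in> \<F>" for l
    using F(4)[OF zl] .
  ultimately show "?P \<inter> {x. z \<bullet> x = 0} \<in> {{x. \<forall>l. x $ l \<in> Gs l} | Gs. \<forall>l. Gs l \<in> \<F>}"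
    by (intro CollectI exI[of _ "\<lambda>l. Fs l \<inter> {u. z $ l \<bullet> u = 0}"]) simp
  fix R
  have "\<exists>C\<ge>0. \<forall>u\<in>Fs l. norm u \<le> R \<longrightarrow>
      (\<exists>u'\<in>Fs l. z $ l \<bullet> u' = 0 \<and> (norm (u - u'))\<^sup>2 \<le> C * (z $ l \<bullet> u))" for l
    using F(5)[OF zl] .
  then obtain C where C: "\<And>l. C l \<ge> 0" "\<And>l u. u \<in> Fs l \<Longrightarrow> norm u \<le> R \<Longrightarrow>
      \<exists>u'\<in>Fs l. z $ l \<bullet> u' = 0 \<and> (norm (u - u'))\<^sup>2 \<le> C l * (z $ l \<bullet> u)"
    by metis
  show "\<exists>C\<ge>0. \<forall>x\<in>?P. norm x \<le> R \<longrightarrow>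
      (\<exists>x'\<in>?P. z \<bullet> x' = 0 \<and> (norm (x - x'))\<^sup>2 \<le> C * (z \<bullet> x))"
  proof (intro exI[of _ "sum C UNIV"] conjI ballI impI)
    show "0 \<le> sum C UNIV" using C(1) by (simp add: sum_nonneg)
    fix x assume x: "x \<in> ?P" "norm x \<le> R"
    have "norm (x $ l) \<le> R" for l
      using x(2) Finite_Cartesian_Product.norm_nth_le[of x l] by linarith
    then have "\<forall>l. \<exists>u'\<in>Fs l. z $ l \<bullet> u' = 0 \<and> (norm (x $ l - u'))\<^sup>2 \<le> C l * (z $ l \<bullet> x $ l)"
      using C(2) x(1) by blast
    then obtain h where h: "\<And>l. h l \<in> Fs l" "\<And>l. z $ l \<bullet> h l = 0"
        "\<And>l. (norm (x $ l - h l))\<^sup>2 \<le> C l * (z $ l \<bullet> x $ l)"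
      by metis
    define x' where "x' = vec_lambda h"
    have "(norm (x - x'))\<^sup>2 = (\<Sum>l\<in>UNIV. (norm (x $ l - h l))\<^sup>2)"
      by (simp add: power2_norm_eq_inner inner_vec_def x'_def)
    also have "\<dots> \<le> (\<Sum>l\<in>UNIV. C l * (z \<bullet> x))"
    proof (rule sum_mono)
      fix l
      have "z $ l \<bullet> x $ l \<le> z \<bullet> x"
        unfolding inner_vec_def using zl x(1) by (intro member_le_sum) auto
      then show "(norm (x $ l - h l))\<^sup>2 \<le> C l * (z \<bullet> x)"
        using h(3)[of l] C(1)[of l] by (meson mult_left_mono order_trans)
    qed
    finally have "(norm (x - x'))\<^sup>2 \<le> sum C UNIV * (z \<bullet> x)"
      by (simp add: sum_distrib_right)
    moreover have "x' \<in> ?P" "z \<bullet> x' = 0"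
      using h by (simp_all add: x'_def inner_vec_def)
    ultimately show "\<exists>x'\<in>?P. z \<bullet> x' = 0 \<and> (norm (x - x'))\<^sup>2 \<le> sum C UNIV * (z \<bullet> x)"
      by blast
  qed
qed

text \<open>Pinning the coordinates outside \<open>I\<close> to zero covers all faces of the
  nonnegative orthant at once, so that exposing a face only shrinks \<open>I\<close>.\<close>

definition coordinate_cone :: "'a::euclidean_space set \<Rightarrow> 'a set" where
  "coordinate_cone I = {x. \<forall>b\<in>Basis. if b \<in> I then 0 \<le> x \<bullet> b else x \<bullet> b = 0}"

lemma facially_regular_coordinate_cones:
  "facially_regular (range (coordinate_cone :: 'a::euclidean_space set \<Rightarrow> 'a set))"
  unfolding facially_regular_def
proof (clarify, intro conjI allI impI)
  fix I :: "'a set"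
  let ?F = "coordinate_cone I"
  show "convex ?F"
    unfolding convex_def coordinate_cone_def by (auto simp: inner_add_left)
  show "cone ?F" by (auto simp: coordinate_cone_def cone_def)
  show "0 \<in> ?F" by (simp add: coordinate_cone_def)
  fix z :: 'a
  assume z: "\<forall>x\<in>?F. 0 \<le> z \<bullet> x"
  have zb: "0 \<le> z \<bullet> b" if "b \<in> Basis" "b \<in> I" for b
  proof -
    have "b \<in> ?F" using that by (auto simp: coordinate_cone_def inner_Basis)
    with z show ?thesis by blast
  qed
  have zbx: "0 \<le> (z \<bullet> b) * (x \<bullet> b)" if "b \<in> Basis" "x \<in> ?F" for b x
    using that zb[of b] by (auto simp: coordinate_cone_def split: if_splits)
  let ?J = "{b\<in>I. z \<bullet> b = 0}"
  have face: "x \<in> coordinate_cone ?J \<longleftrightarrow> x \<in> ?F \<and> z \<bullet> x = 0" for x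
  proof
    assume x: "x \<in> coordinate_cone ?J"
    then have xb: "if b \<in> I \<and> z \<bullet> b = 0 then 0 \<le> x \<bullet> b else x \<bullet> b = 0" if "b \<in> Basis" for b
      using that by (simp add: coordinate_cone_def)
    have "(z \<bullet> b) * (x \<bullet> b) = 0" if "b \<in> Basis" for b
      using xb[OF that] by (auto split: if_splits)
    then have "z \<bullet> x = 0" 
      by (subst euclidean_inner) (intro sum.neutral ballI)
    moreover have "if b \<in> I then 0 \<le> x \<bullet> b else x \<bullet> b = 0" if "b \<in> Basis" for b
      using xb[OF that] by (auto split: if_splits)
    then have "x \<in> ?F" by (simp add: coordinate_cone_def)
    ultimately show "x \<in> ?F \<and> z \<bullet> x = 0" by simp
  next
    assume x: "x \<in> ?F \<and> z \<bullet> x = 0"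
    then have "(\<Sum>b\<in>Basis. (z \<bullet> b) * (x \<bullet> b)) = 0" by (simp flip: euclidean_inner)
    then have zx: "(z \<bullet> b) * (x \<bullet> b) = 0" if "b \<in> Basis" for b
      using zbx x that by (subst (asm) sum_nonneg_eq_0_iff) auto
    have "if b \<in> ?J then 0 \<le> x \<bullet> b else x \<bullet> b = 0" if b: "b \<in> Basis" for b
      using x zx[OF b] b by (auto simp: coordinate_cone_def split: if_splits)
    then show "x \<in> coordinate_cone ?J" by (simp add: coordinate_cone_def)
  qed
  have "?F \<inter> {x. z \<bullet> x = 0} = coordinate_cone ?J"
    using face by auto
  then show "?F \<inter> {x. z \<bullet> x = 0} \<in> range coordinate_cone" by blast
  fix R
  \<comment> \<open>A coordinate with \<open>z \<bullet> b > 0\<close> is set to zero in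
    \<open>x'\<close>, and its square is at most \<open>\<bar>R\<bar>\<close> times itself. Where
    \<open>z \<bullet> b = 0\<close>, \<open>x\<close> and \<open>x'\<close> agree, and
    \<open>inverse 0 = 0\<close> drops the term.\<close>
  let ?C = "\<bar>R\<bar> * (\<Sum>b\<in>Basis. inverse \<bar>z \<bullet> b\<bar>)"
  show "\<exists>C\<ge>0. \<forall>x\<in>?F. norm x \<le> R \<longrightarrow>
      (\<exists>x'\<in>?F. z \<bullet> x' = 0 \<and> (norm (x - x'))\<^sup>2 \<le> C * (z \<bullet> x))"
  proof (intro exI[of _ ?C] conjI ballI impI)
    show "0 \<le> ?C" by (simp add: sum_nonneg)
    fix x assume x: "x \<in> ?F" "norm x \<le> R"
    define x' where "x' = (\<Sum>b\<in>Basis. (if b \<in> ?J then x \<bullet> b else 0) *\<^sub>R b)"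
    have x'b: "x' \<bullet> b = (if b \<in> ?J then x \<bullet> b else 0)" if "b \<in> Basis" for b
      using that by (simp add: x'_def inner_sum_left_Basis)
    have "x' \<in> coordinate_cone ?J"
      using x(1) x'b by (auto simp: coordinate_cone_def split: if_splits)
    have "((x - x') \<bullet> b)\<^sup>2 \<le> \<bar>R\<bar> * inverse \<bar>z \<bullet> b\<bar> * (z \<bullet> x)" if b: "b \<in> Basis" for b
    proof (cases "b \<in> I \<and> z \<bullet> b \<noteq> 0")
      case True
      then have pos: "z \<bullet> b > 0" "x \<bullet> b \<ge> 0"
        using zb[OF b] x(1) b by (auto simp: coordinate_cone_def)
      have "x \<bullet> b \<le> \<bar>R\<bar>"
        using Basis_le_norm[OF b, of x] x(2) by linarith
      then have "(x \<bullet> b)\<^sup>2 \<le> \<bar>R\<bar> * (x \<bullet> b)"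
        using pos by (simp add: power2_eq_square mult_right_mono)
      also have "\<dots> = \<bar>R\<bar> * inverse \<bar>z \<bullet> b\<bar> * ((z \<bullet> b) * (x \<bullet> b))"
        using pos by simp
      also have "(z \<bullet> b) * (x \<bullet> b) \<le> z \<bullet> x"
        unfolding euclidean_inner[of z x] using zbx x(1) b by (intro member_le_sum) auto
      finally show ?thesis
        using True b by (simp add: inner_diff_left x'b mult_left_mono)
    next
      case False
      then have "(x - x') \<bullet> b = 0"
        using x(1) b by (auto simp: inner_diff_left x'b coordinate_cone_def)
      moreover have "0 \<le> z \<bullet> x" using z x(1) by blast
      ultimately show ?thesis by simp
    qed
    then have "(\<Sum>b\<in>Basis. ((x - x') \<bullet> b)\<^sup>2) \<le> (\<Sum>b\<in>Basis. \<bar>R\<bar> * inverse \<bar>z \<bullet> b\<bar> * (z \<bullet> x))"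
      by (rule sum_mono)
    then have "(norm (x - x'))\<^sup>2 \<le> ?C * (z \<bullet> x)"
      by (simp add: power2_norm_eq_inner euclidean_inner[of "x - x'" "x - x'"] sum_distrib_left
          sum_distrib_right flip: power2_eq_square)
    then show "\<exists>x'\<in>?F. z \<bullet> x' = 0 \<and> (norm (x - x'))\<^sup>2 \<le> ?C * (z \<bullet> x)"
      using face \<open>x' \<in> coordinate_cone ?J\<close> by blast
  qed
qed

text \<open>\<open>ray 0\<close> is the trivial cone, so \<open>range ray\<close> contains every
  proper exposed face of a second-order cone, the vertex included.\<close>

definition ray :: "'a::real_vector \<Rightarrow> 'a set" where
  "ray v = {t *\<^sub>R v | t. 0 \<le> t}"

definition second_order_cone :: "'a::real_inner \<Rightarrow> 'a set" where
  "second_order_cone e = {x. norm (x - (x \<bullet> e) *\<^sub>R e) \<le> x \<bullet> e}"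

text \<open>A nonzero functional in the interior of the dual cone exposes only the vertex; one on
  its boundary exposes a single ray. Near that ray the cone is in general tangent to the hyperplane,
  which is where the square in the estimate comes from.\<close>

lemma facially_regular_second_order_cone:
  fixes e :: "'a::euclidean_space"
  assumes e: "norm e = 1"
  shows "facially_regular (insert (second_order_cone e) (range ray))"
proof -
  let ?\<F> = "insert (second_order_cone e) (range (ray :: 'a \<Rightarrow> 'a set))"
  define Q where "Q = second_order_cone e"
  define pr where "pr x = x - (x \<bullet> e) *\<^sub>R e" for x
  have Q: "x \<in> Q \<longleftrightarrow> norm (pr x) \<le> x \<bullet> e" for x by (simp add: Q_def second_order_cone_def pr_def)
  have ee: "e \<bullet> e = 1" using e by (simp add: norm_eq_sqrt_inner)
  have pr_add: "pr (x + y) = pr x + pr y" and pr_scale: "pr (t *\<^sub>R x) = t *\<^sub>R pr x"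
    and pr_e: "pr x \<bullet> e = 0" for x y t
    by (simp_all add: pr_def algebra_simps inner_diff_left ee)
  have split: "x \<bullet> y = (x \<bullet> e) * (y \<bullet> e) + pr x \<bullet> pr y" for x y
    by (simp add: pr_def inner_diff_left inner_diff_right ee inner_commute algebra_simps)
  have dual: "z \<in> Q" if z: "\<And>x. x \<in> Q \<Longrightarrow> 0 \<le> z \<bullet> x" for z
  proof (cases "pr z = 0")
    case True
    have "e \<in> Q" by (simp add: Q pr_def ee)
    from z[OF this] True show ?thesis by (simp add: Q)
  next
    case False
    \<comment> \<open>Among the points of the cone at its height, this one has the smallest pairing
      with \<open>z\<close>.\<close>
    let ?x = "norm (pr z) *\<^sub>R e - pr z"
    have xe: "?x \<bullet> e = norm (pr z)" by (simp add: inner_diff_left ee pr_e)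
    have prx: "pr ?x = - pr z" unfolding pr_def[of ?x] xe by simp
    have "?x \<in> Q" by (simp add: Q xe prx)
    from z[OF this] have "0 \<le> norm (pr z) * (z \<bullet> e) - pr z \<bullet> pr z"
      by (simp add: split[of z ?x] xe prx mult.commute)
    then have "norm (pr z) * norm (pr z) \<le> norm (pr z) * (z \<bullet> e)"
      by (simp add: power2_norm_eq_inner[symmetric] power2_eq_square)
    then show ?thesis using False by (simp add: Q)
  qed
  have rays: "convex F \<and> cone F \<and> 0 \<in> F \<and>
     (\<forall>z. (\<forall>x\<in>F. 0 \<le> z \<bullet> x) \<longrightarrow> F \<inter> {x. z \<bullet> x = 0} \<in> ?\<F> \<and>
        (\<forall>R. \<exists>C\<ge>0. \<forall>x\<in>F. norm x \<le> R \<longrightarrow>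
           (\<exists>x'\<in>F. z \<bullet> x' = 0 \<and> (norm (x - x'))\<^sup>2 \<le> C * (z \<bullet> x))))" if F: "F = ray v" for F v
  proof (intro conjI allI impI)
    show "convex F"
    proof (rule convexI)
      fix x y and s t :: real
      assume "x \<in> F" "y \<in> F" and st: "0 \<le> s" "0 \<le> t" "s + t = 1"
      then obtain a b where "x = a *\<^sub>R v" "y = b *\<^sub>R v" "0 \<le> a" "0 \<le> b" by (auto simp: F ray_def)
      then show "s *\<^sub>R x + t *\<^sub>R y \<in> F" unfolding F ray_def using st
        by (intro CollectI exI[of _ "s * a + t * b"]) (simp add: scaleR_add_left)
    qed
    show "cone F" unfolding cone_def F ray_def by (auto intro!: exI[of _ "_ * _"])
    show "0 \<in> F" unfolding F ray_def by (auto intro!: exI[of _ 0])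
    fix z assume z: "\<forall>x\<in>F. 0 \<le> z \<bullet> x"
    have "v \<in> F" unfolding F ray_def by (auto intro!: exI[of _ 1])
    with z have zv: "0 \<le> z \<bullet> v" by blast
    have "F \<inter> {x. z \<bullet> x = 0} = (if z \<bullet> v = 0 then ray v else ray 0)"
      by (auto simp: F ray_def)
    then show "F \<inter> {x. z \<bullet> x = 0} \<in> ?\<F>" by simp
    fix R
    show "\<exists>C\<ge>0. \<forall>x\<in>F. norm x \<le> R \<longrightarrow>
           (\<exists>x'\<in>F. z \<bullet> x' = 0 \<and> (norm (x - x'))\<^sup>2 \<le> C * (z \<bullet> x))"
    proof (cases "z \<bullet> v = 0")
      case True
      then have "\<forall>x\<in>F. z \<bullet> x = 0" by (auto simp: F ray_def)
      then show ?thesis by (intro exI[of _ 0]) auto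
    next
      case False
      with zv have zv: "0 < z \<bullet> v" by simp
      let ?C = "\<bar>R\<bar> * norm v / (z \<bullet> v)"
      have "(norm (x - 0))\<^sup>2 \<le> ?C * (z \<bullet> x)" if x: "x \<in> F" "norm x \<le> R" for x
      proof -
        obtain t where t: "x = t *\<^sub>R v" "0 \<le> t" using x(1) unfolding F ray_def by blast
        have "norm x * norm x \<le> \<bar>R\<bar> * norm x" using x(2) by (intro mult_right_mono) auto
        also have "\<dots> = ?C * (z \<bullet> x)" using zv t by simp
        finally show ?thesis by (simp add: power2_eq_square)
      qed
      moreover have "?C \<ge> 0" using zv by simp
      moreover have "0 \<in> F" unfolding F ray_def by (auto intro!: exI[of _ 0])
      ultimately show ?thesis by (metis inner_zero_right)
    qed
  qed
  have "convex Q" unfolding convex_def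
  proof (intro ballI allI impI)
    fix x y and s t :: real
    assume "x \<in> Q" "y \<in> Q" and st: "0 \<le> s" "0 \<le> t" "s + t = 1"
    then have xy: "norm (pr x) \<le> x \<bullet> e" "norm (pr y) \<le> y \<bullet> e" by (simp_all add: Q)
    have "norm (pr (s *\<^sub>R x + t *\<^sub>R y)) \<le> s * norm (pr x) + t * norm (pr y)"
      using norm_triangle_ineq[of "s *\<^sub>R pr x" "t *\<^sub>R pr y"] st by (simp add: pr_add pr_scale)
    also have "\<dots> \<le> s * (x \<bullet> e) + t * (y \<bullet> e)"
      using xy st by (intro add_mono mult_left_mono)
    finally show "s *\<^sub>R x + t *\<^sub>R y \<in> Q" by (simp add: Q inner_add_left)
  qed
  moreover have "cone Q" by (auto simp: cone_def Q pr_scale intro: mult_left_mono)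
  moreover have Q0: "0 \<in> Q" by (simp add: Q pr_def)
  moreover have "Q \<inter> {x. z \<bullet> x = 0} \<in> ?\<F> \<and>
        (\<forall>R. \<exists>C\<ge>0. \<forall>x\<in>Q. norm x \<le> R \<longrightarrow>
           (\<exists>x'\<in>Q. z \<bullet> x' = 0 \<and> (norm (x - x'))\<^sup>2 \<le> C * (z \<bullet> x)))"
    if z: "\<forall>x\<in>Q. 0 \<le> z \<bullet> x" for z
  proof (cases "z = 0")
    case True
    have "Q \<inter> {x. z \<bullet> x = 0} \<in> ?\<F>" using True by (simp add: Q_def)
    moreover have "\<exists>C\<ge>0. \<forall>x\<in>Q. norm x \<le> R \<longrightarrow>
           (\<exists>x'\<in>Q. z \<bullet> x' = 0 \<and> (norm (x - x'))\<^sup>2 \<le> C * (z \<bullet> x))" for R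
      using True by (intro exI[of _ 0]) (auto intro!: bexI[of _ "_ :: 'a"])
    ultimately show ?thesis by blast
  next
    case False
    define a where "a = z \<bullet> e"
    have zQ: "norm (pr z) \<le> a" using dual[of z] z by (simp add: Q a_def)
    have "a \<noteq> 0"
    proof
      assume "a = 0"
      with zQ have "z = 0" using pr_def[of z] by (simp add: a_def)
      with False show False by simp
    qed
    then have a: "a > 0" using zQ norm_ge_zero[of "pr z"] by linarith
    \<comment> \<open>The point of \<open>ray v\<close> (trivial if \<open>z\<close> is interior) with the same height as \<open>x\<close>.\<close>
    define v where "v = (if norm (pr z) = a then a *\<^sub>R e - pr z else 0)"
    define C where "C R = (if norm (pr z) = a then 2 * \<bar>R\<bar> / a else 2 * \<bar>R\<bar> / (a - norm (pr z)))" for R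
    have C0: "C R \<ge> 0" for R using a zQ by (simp add: C_def)
    have ve: "a *\<^sub>R e - pr z \<in> Q" if "norm (pr z) = a"
    proof -
      have xe: "(a *\<^sub>R e - pr z) \<bullet> e = a" by (simp add: inner_diff_left ee pr_e)
      show ?thesis unfolding Q pr_def[of "a *\<^sub>R e - pr z"] xe using that by simp
    qed
    have vQ: "v \<in> Q" using ve Q0 by (simp add: v_def)
    have zv: "z \<bullet> v = 0"
    proof -
      have "z \<bullet> (a *\<^sub>R e - pr z) = a * a - norm (pr z) * norm (pr z)"
        using split[of z "pr z"]
        by (simp add: inner_diff_right a_def pr_e pr_def[of "pr z"]
            power2_norm_eq_inner[symmetric] power2_eq_square)
      then show ?thesis by (simp add: v_def)
    qed
    have rayQ: "ray v \<subseteq> Q" using vQ \<open>cone Q\<close> by (auto simp: ray_def cone_def)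
    have zray: "z \<bullet> x = 0" if "x \<in> ray v" for x using that zv by (auto simp: ray_def)
    have near: "\<exists>x'\<in>ray v. (norm (x - x'))\<^sup>2 \<le> C R * (z \<bullet> x)" if x: "x \<in> Q" "norm x \<le> R" for x R
    proof -
      define h where "h = x \<bullet> e"
      have prx: "norm (pr x) \<le> h" using x(1) by (simp add: Q h_def)
      then have h0: "0 \<le> h" using norm_ge_zero[of "pr x"] by linarith
      have "h \<le> norm x" using norm_cauchy_schwarz[of x e] e by (simp add: h_def)
      then have hR: "h \<le> \<bar>R\<bar>" using x(2) by linarith
      have zx: "z \<bullet> x = a * h + pr z \<bullet> pr x" by (simp add: split[of z x] a_def h_def)
      have prx2: "pr x \<bullet> pr x \<le> h * h"
        using prx by (metis norm_ge_zero mult_mono h0 power2_norm_eq_inner power2_eq_square)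
      show ?thesis
      proof (cases "norm (pr z) = a")
        case True
        let ?x = "(h / a) *\<^sub>R v"
        have "x - ?x = pr x + (h / a) *\<^sub>R pr z"
          using a True by (simp add: v_def pr_def[of x] h_def scaleR_diff_right)
        then have "(norm (x - ?x))\<^sup>2 = pr x \<bullet> pr x + 2 * (h / a) * (pr z \<bullet> pr x) + (h / a)\<^sup>2 * (pr z \<bullet> pr z)"
          unfolding power2_norm_eq_inner
          by (simp add: inner_add_left inner_add_right inner_commute power2_eq_square)
        also have "pr z \<bullet> pr z = a\<^sup>2" using True by (simp add: power2_norm_eq_inner[symmetric])
        also have "(h / a)\<^sup>2 * a\<^sup>2 = h * h" using a by (simp add: power2_eq_square)
        \<comment> \<open>Replacing \<open>pr x \<bullet> pr x\<close> by its bound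
          \<open>h * h\<close> turns the left side into exactly
          \<open>2 * h / a * (z \<bullet> x)\<close>.\<close>
        also have "pr x \<bullet> pr x + 2 * (h / a) * (pr z \<bullet> pr x) + h * h \<le> 2 * h / a * (z \<bullet> x)"
          using prx2 a by (simp add: zx field_simps)
        also have "\<dots> \<le> C R * (z \<bullet> x)"
          using hR a True z x(1) by (intro mult_right_mono) (auto simp: C_def divide_right_mono)
        finally show ?thesis using h0 a by (intro bexI[of _ ?x]) (auto simp: ray_def intro!: exI[of _ "h / a"])
      next
        case False
        with zQ have an: "a - norm (pr z) > 0" by simp
        have "- (pr z \<bullet> pr x) \<le> norm (pr z) * norm (pr x)"
          using norm_cauchy_schwarz[of "- pr z" "pr x"] by simp
        also have "\<dots> \<le> norm (pr z) * h" using prx by (rule mult_left_mono) simp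
        finally have zh: "(a - norm (pr z)) * h \<le> z \<bullet> x" by (simp add: zx algebra_simps)
        have "(norm x)\<^sup>2 = h * h + pr x \<bullet> pr x" by (simp add: power2_norm_eq_inner split[of x x] h_def)
        also have "\<dots> \<le> 2 * (h * h)" using prx2 by simp
        also have "\<dots> \<le> 2 * (\<bar>R\<bar> * h)" using hR h0 by (simp add: mult_right_mono)
        also have "\<dots> = C R * ((a - norm (pr z)) * h)" using False an by (simp add: C_def)
        also have "\<dots> \<le> C R * (z \<bullet> x)" using zh C0 by (rule mult_left_mono)
        finally show ?thesis by (intro bexI[of _ 0]) (auto simp: ray_def intro!: exI[of _ 0])
      qed
    qed
    \<comment> \<open>At \<open>z \<bullet> x = 0\<close> the distance estimate also identifies the
      face.\<close>
    have "Q \<inter> {x. z \<bullet> x = 0} = ray v"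
    proof (intro set_eqI iffI)
      fix x assume "x \<in> Q \<inter> {x. z \<bullet> x = 0}"
      then show "x \<in> ray v" using near[of x "norm x"] by auto
    qed (use rayQ zray in auto)
    then have face: "Q \<inter> {x. z \<bullet> x = 0} \<in> ?\<F>" by simp
    have "\<exists>x'\<in>Q. z \<bullet> x' = 0 \<and> (norm (x - x'))\<^sup>2 \<le> C R * (z \<bullet> x)"
      if x: "x \<in> Q" "norm x \<le> R" for x R
    proof -
      obtain x' where "x' \<in> ray v" "(norm (x - x'))\<^sup>2 \<le> C R * (z \<bullet> x)"
        using near[OF x] by (elim bexE)
      then show ?thesis using rayQ zray[of x'] by (intro bexI[of _ x']) auto
    qed
    then show ?thesis using face C0 by (intro conjI allI exI[of _ "C _"] ballI impI) simp_all
  qed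
  ultimately show ?thesis
    using rays unfolding facially_regular_def Q_def[symmetric] by simp
qed

section \<open>Descent with an error bound\<close>

text \<open>Concavity of \<open>t powr \<theta>\<close> at \<open>a\<close>, multiplied by
  \<open>a\<close> to avoid a negative exponent; it follows from the weighted AM-GM
  inequality.\<close>

lemma powr_diff_ge:
  fixes a b \<theta> :: real
  assumes "0 < \<theta>" "\<theta> \<le> 1" "0 < a" "0 \<le> b"
  shows "\<theta> * (a - b) * a powr \<theta> \<le> a * (a powr \<theta> - b powr \<theta>)"
proof -
  have "b powr \<theta> * a powr (1 - \<theta>) \<le> \<theta> * b + (1 - \<theta>) * a"
    using assms Youngs_inequality_0[of \<theta> "1 - \<theta>" b a] by (cases "b = 0") auto
  then have "b powr \<theta> * a powr (1 - \<theta>) * a powr \<theta> \<le> (\<theta> * b + (1 - \<theta>) * a) * a powr \<theta>"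
    by (rule mult_right_mono) simp
  moreover have "a powr (1 - \<theta>) * a powr \<theta> = a"
    using assms by (simp flip: powr_add)
  ultimately have "b powr \<theta> * a \<le> (\<theta> * b + (1 - \<theta>) * a) * a powr \<theta>"
    by (simp add: mult.assoc)
  then show ?thesis by (simp add: algebra_simps)
qed

text \<open>The Kurdyka--Lojasiewicz argument with desingularising function \<open>s \<mapsto> s powr \<theta>\<close>.\<close>

lemma summable_steps_of_descent:
  fixes \<Phi> D :: "nat \<Rightarrow> real"
  assumes \<Phi>: "\<And>k. 0 \<le> \<Phi> k" and D: "\<And>k. 0 \<le> D k"
    and c: "c > 0" and descent: "\<And>k. c * (D k)\<^sup>2 \<le> \<Phi> k - \<Phi> (Suc k)"
    and \<theta>: "0 < \<theta>" "\<theta> \<le> 1" and C: "C \<ge> 0"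
    and KL: "\<And>k. \<Phi> (Suc k) \<le> C * D k * \<Phi> (Suc k) powr \<theta>"
  shows "summable D"
proof -
  define K where "K = C / (c * \<theta>)"
  have K0: "K \<ge> 0" using C c \<theta> by (simp add: K_def)
  define E where "E k = \<Phi> (Suc k) powr \<theta> - \<Phi> (Suc (Suc k)) powr \<theta>" for k
  have mono: "\<Phi> (Suc k) \<le> \<Phi> k" for k
    using descent[of k] c by (smt (verit) mult_nonneg_nonneg zero_le_power2)
  have E0: "E k \<ge> 0" for k
    using mono[of "Suc k"] \<Phi> \<theta> by (simp add: E_def powr_mono2)
  \<comment> \<open>AM-GM applied to the product \<open>D k * (K * E k)\<close> that bounds the
    square of \<open>D (Suc k)\<close>; the terms \<open>E k\<close> telescope.\<close>
  have step: "2 * D (Suc k) \<le> D k + K * E k" for k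
  proof (cases "\<Phi> (Suc k) = 0")
    case True
    then have "c * (D (Suc k))\<^sup>2 \<le> 0"
      using descent[of "Suc k"] \<Phi>[of "Suc (Suc k)"] by simp
    then have "D (Suc k) = 0" using c by (simp add: mult_le_0_iff)
    then show ?thesis using D[of k] K0 E0[of k] by simp
  next
    case False
    define a b where "a = \<Phi> (Suc k)" and "b = \<Phi> (Suc (Suc k))"
    have a: "a > 0" using False \<Phi>[of "Suc k"] by (simp add: a_def)
    have "\<theta> * (a - b) * a powr \<theta> \<le> a * E k"
      using powr_diff_ge[OF \<theta> a, of b] \<Phi> by (simp add: E_def a_def b_def)
    also have "\<dots> \<le> (C * D k * a powr \<theta>) * E k"
      using KL[of k] E0[of k] by (intro mult_right_mono) (simp_all add: a_def)
    finally have "(\<theta> * (a - b)) * a powr \<theta> \<le> (C * D k * E k) * a powr \<theta>"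
      by (simp add: algebra_simps)
    then have "\<theta> * (a - b) \<le> C * D k * E k"
      using a by simp
    then have "\<theta> * (c * (D (Suc k))\<^sup>2) \<le> C * D k * E k"
      using descent[of "Suc k"] \<theta> unfolding a_def b_def
      by (meson less_imp_le mult_left_mono order_trans)
    then have "(D (Suc k))\<^sup>2 \<le> D k * (K * E k)"
      using c \<theta> by (simp add: K_def field_simps)
    then have "(2 * D (Suc k))\<^sup>2 \<le> 4 * (D k * (K * E k))"
      by (simp add: power_mult_distrib)
    also have "\<dots> \<le> (D k + K * E k)\<^sup>2"
      using sum_squares_bound[of "D k" "K * E k"] by (simp add: power2_sum algebra_simps)
    finally show ?thesis
      by (rule power2_le_imp_le) (use D[of k] K0 E0[of k] in simp)
  qed
  \<comment> \<open>The extra \<open>D n\<close> on the left is what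
    \<open>2 * D (Suc n) \<le> D n + K * E n\<close> consumes in the induction.\<close>
  have partial: "(\<Sum>k<Suc n. D k) + D n \<le> 2 * D 0 + K * (\<Phi> (Suc 0) powr \<theta> - \<Phi> (Suc n) powr \<theta>)" for n
  proof (induction n)
    case (Suc n)
    then show ?case using step[of n] by (simp add: E_def algebra_simps)
  qed simp
  have "(\<Sum>k<n. D k) \<le> 2 * D 0 + K * \<Phi> (Suc 0) powr \<theta>" for n
  proof -
    have "(\<Sum>k<n. D k) \<le> (\<Sum>k<Suc n. D k) + D n" using D[of n] by simp
    also have "\<dots> \<le> 2 * D 0 + K * \<Phi> (Suc 0) powr \<theta>"
      using partial[of n] K0 by (smt (verit) mult_left_mono powr_ge_zero)
    finally show ?thesis .
  qed
  then show ?thesis using D by (rule summableI_nonneg_bounded[rotated])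
qed

lemma convergent_of_summable_steps:
  fixes x :: "nat \<Rightarrow> 'a::banach"
  assumes "summable (\<lambda>k. norm (x (Suc k) - x k))"
  obtains p where "x \<longlonglongrightarrow> p"
proof -
  have "(\<lambda>n. \<Sum>k<n. x (Suc k) - x k) \<longlonglongrightarrow> (\<Sum>k. x (Suc k) - x k)"
    using summable_norm_cancel[OF assms] by (rule summable_LIMSEQ)
  then have "(\<lambda>n. x n - x 0) \<longlonglongrightarrow> (\<Sum>k. x (Suc k) - x k)"
    by (simp add: sum_lessThan_telescope)
  from tendsto_add[OF this tendsto_const[of "x 0"]] show ?thesis
    using that by simp
qed

text \<open>Nonnegativity of the form at \<open>b *\<^sub>R u - S u\<close> gives the bound without
  a square root of \<open>S\<close>. A small value of the form thus forces \<open>S u\<close> to be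
  small, even when \<open>u\<close> is not.\<close>

lemma psd_norm_bound:
  fixes S :: "'a::euclidean_space \<Rightarrow> 'a"
  assumes S: "linear S" and sym: "\<And>u v. S u \<bullet> v = u \<bullet> S v" and psd: "\<And>u. 0 \<le> S u \<bullet> u"
  obtains b where "b > 0" "\<And>u. (norm (S u))\<^sup>2 \<le> b * (S u \<bullet> u)"
proof -
  obtain b where b: "b > 0" "\<And>x. norm (S x) \<le> b * norm x"
    using linear_bounded_pos[OF S] by blast
  have "(norm (S u))\<^sup>2 \<le> b * (S u \<bullet> u)" for u
  proof -
    define s where "s = S u"
    have "S s \<bullet> s \<le> norm (S s) * norm s" by (rule norm_cauchy_schwarz)
    also have "\<dots> \<le> b * norm s * norm s" by (intro mult_right_mono b) simp
    finally have Ss: "S s \<bullet> s \<le> b * (s \<bullet> s)"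
      by (simp add: power2_norm_eq_inner[symmetric] power2_eq_square mult.assoc)
    have "0 \<le> S (b *\<^sub>R u - s) \<bullet> (b *\<^sub>R u - s)" by (rule psd)
    also have "\<dots> = b * b * (S u \<bullet> u) - 2 * b * (s \<bullet> s) + S s \<bullet> s"
      using sym[of s u] by (simp add: s_def linear_diff[OF S] linear_scale[OF S]
          inner_diff_left inner_diff_right inner_commute algebra_simps)
    finally have "b * (s \<bullet> s) \<le> b * (b * (S u \<bullet> u))" using Ss by (simp add: algebra_simps)
    then show ?thesis using b(1) by (simp add: s_def power2_norm_eq_inner)
  qed
  with b(1) that show ?thesis by blast
qed

lemma le_powr_inverse:
  fixes a b :: real
  assumes "0 \<le> a" "0 < N" "a ^ N \<le> b"
  shows "a \<le> b powr (1 / real N)"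
proof (cases "a = 0")
  case False
  then have "a = (a ^ N) powr (1 / real N)"
    using assms by (simp add: powr_powr flip: powr_realpow)
  also have "\<dots> \<le> b powr (1 / real N)" using assms by (intro powr_mono2) auto
  finally show ?thesis .
qed simp

text \<open>A sweep enters only through \<open>descent\<close> and \<open>grad\<close>. The
  translation \<open>d\<close> admits constraint sets such as \<open>H_pure_floor \<xi>\<close> that
  are not cones.\<close>

proposition quadratic_descent_converges:
  fixes S :: "'a::euclidean_space \<Rightarrow> 'a" and B d :: 'a and x :: "nat \<Rightarrow> 'a"
  defines "f \<equiv> \<lambda>u. S u \<bullet> u / 2 - B \<bullet> u"
  assumes S: "linear S" and sym: "\<And>u v. S u \<bullet> v = u \<bullet> S v" and psd: "\<And>u. 0 \<le> S u \<bullet> u"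
    and fam: "facially_regular \<F>" "F \<in> \<F>" and "closed F" and X: "X = (+) d ` F"
    and xX: "\<And>k. x k \<in> X" and bd: "\<And>k. norm (x k) \<le> R"
    and c: "c > 0" and descent: "\<And>k. c * (norm (x (Suc k) - x k))\<^sup>2 \<le> f (x k) - f (x (Suc k))"
    and grad: "\<And>k y. y \<in> X \<Longrightarrow> (S (x (Suc k)) - B) \<bullet> (x (Suc k) - y)
                 \<le> L * norm (x (Suc k) - x k) * norm (x (Suc k) - y)"
    and L: "L \<ge> 0"
  shows "\<exists>p\<in>X. x \<longlonglongrightarrow> p \<and> (\<forall>y\<in>X. 0 \<le> (S p - B) \<bullet> (y - p))"
proof -
  have expand: "f u - f v = (S v - B) \<bullet> (u - v) + S (u - v) \<bullet> (u - v) / 2" for u v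
    using sym[of u v] by (simp add: f_def linear_diff[OF S] inner_diff_left inner_diff_right
        inner_commute[of _ "S v"] field_simps)
  have contS: "continuous_on UNIV S" using S by (rule linear_continuous_on_compose[OF continuous_on_id])
  have Slim: "(\<lambda>j. S (u j)) \<longlonglongrightarrow> S p" if "u \<longlonglongrightarrow> p" for u p
    using that linear_bounded_pos[OF S] continuous_on_tendsto_compose[OF contS that] by auto
  define D where "D k = norm (x (Suc k) - x k)" for k
  have dec: "f (x (Suc k)) \<le> f (x k)" for k
    using descent[of k] c by (smt (verit) mult_nonneg_nonneg zero_le_power2)
  have decs: "f (x j) \<le> f (x i)" if "i \<le> j" for i j
    using lift_Suc_antimono_le[of "\<lambda>k. f (x k)"] dec that by blast
  have "bounded (range x)" using bd by (auto simp: bounded_iff)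
  then obtain p \<sigma> where \<sigma>: "strict_mono \<sigma>" and lim: "(x \<circ> \<sigma>) \<longlonglongrightarrow> p"
    using bounded_imp_convergent_subsequence by metis
  \<comment> \<open>\<open>grad\<close> speaks of end points of sweeps, so the subsequence is
    written with indices \<open>Suc (\<tau> j)\<close>; since \<open>\<sigma> (Suc j)\<close> is
    positive, the subtraction is exact.\<close>
  define \<tau> where "\<tau> j = \<sigma> (Suc j) - 1" for j
  have \<tau>: "\<sigma> (Suc j) = Suc (\<tau> j)" "j \<le> \<tau> j" for j
    using strict_mono_imp_increasing[OF \<sigma>, of "Suc j"] by (auto simp: \<tau>_def)
  have lim\<tau>: "(\<lambda>j. x (Suc (\<tau> j))) \<longlonglongrightarrow> p"
    using LIMSEQ_Suc[OF lim] by (simp add: \<tau>(1))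
  have \<tau>_top: "filterlim \<tau> sequentially sequentially"
    using \<tau>(2) by (intro filterlim_at_top_mono[OF filterlim_ident]) auto
  have "closed X" unfolding X using \<open>closed F\<close> by (rule closed_translation)
  then have pX: "p \<in> X" using xX lim\<tau> by (rule closed_sequentially)
  have flim: "(\<lambda>j. f (x (Suc (\<tau> j)))) \<longlonglongrightarrow> f p"
    unfolding f_def using lim\<tau> Slim[OF lim\<tau>] by (intro tendsto_intros) auto
  have fp: "f p \<le> f (x k)" for k
  proof (rule LIMSEQ_le_const2[OF flim])
    show "\<exists>N. \<forall>j\<ge>N. f (x (Suc (\<tau> j))) \<le> f (x k)"
      using \<tau>(2) by (intro exI[of _ k] allI impI decs) (meson le_SucI le_trans)
  qed
  have "decseq (\<lambda>k. f (x k))" using decs by (simp add: decseq_def)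
  then obtain l where l: "(\<lambda>k. f (x k)) \<longlonglongrightarrow> l"
    using decseq_convergent fp by blast
  have "(\<lambda>k. (f (x k) - f (x (Suc k))) / c) \<longlonglongrightarrow> (l - l) / c"
    using l LIMSEQ_Suc[OF l] c by (intro tendsto_intros) auto
  then have null: "(\<lambda>k. (f (x k) - f (x (Suc k))) / c) \<longlonglongrightarrow> 0" by simp
  have "norm ((D k)\<^sup>2) \<le> (f (x k) - f (x (Suc k))) / c" for k
    using descent[of k] c by (simp add: D_def pos_le_divide_eq mult.commute)
  then have "\<forall>\<^sub>F k in sequentially. norm ((D k)\<^sup>2) \<le> (f (x k) - f (x (Suc k))) / c"
    by (intro always_eventually allI)
  from Lim_null_comparison[OF this null] have D2: "(\<lambda>k. (D k)\<^sup>2) \<longlonglongrightarrow> 0" .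
  then have "D \<longlonglongrightarrow> 0"
    using tendsto_real_sqrt[OF D2] by (simp add: D_def[abs_def])
  then have D\<tau>: "(\<lambda>j. D (\<tau> j)) \<longlonglongrightarrow> 0" using \<tau>_top by (rule filterlim_compose)
  define g where "g = S p - B"
  have VI: "0 \<le> g \<bullet> (y - p)" if "y \<in> X" for y
  proof -
    have lhs: "(\<lambda>j. (S (x (Suc (\<tau> j))) - B) \<bullet> (x (Suc (\<tau> j)) - y)) \<longlonglongrightarrow> g \<bullet> (p - y)"
      unfolding g_def using lim\<tau> Slim[OF lim\<tau>] by (intro tendsto_intros)
    have rhs: "(\<lambda>j. L * D (\<tau> j) * norm (x (Suc (\<tau> j)) - y)) \<longlonglongrightarrow> L * 0 * norm (p - y)"
      using lim\<tau> D\<tau> by (intro tendsto_intros)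
    have "g \<bullet> (p - y) \<le> L * 0 * norm (p - y)"
      using lhs rhs by (rule LIMSEQ_le) (use grad[OF that] in \<open>auto simp: D_def\<close>)
    then show ?thesis by (simp add: inner_diff_right)
  qed
  define \<Phi> where "\<Phi> k = f (x k) - f p" for k
  have \<Phi>0: "0 \<le> \<Phi> k" "\<Phi> k \<le> \<Phi> 0" for k using fp decs by (simp_all add: \<Phi>_def)
  obtain b where b: "b > 0" "\<And>u. (norm (S u))\<^sup>2 \<le> b * (S u \<bullet> u)"
    using psd_norm_bound[OF S sym psd] by blast
  \<comment> \<open>The set of minimisers over \<open>X\<close> is the slice of \<open>X\<close> on which \<open>T\<close> agrees with its value at \<open>p\<close>.\<close>
  define T where "T u = (S u, g \<bullet> u)" for u
  have T: "linear T"
    by (rule linearI) (simp_all add: T_def linear_add[OF S] linear_scale[OF S] inner_add_right)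
  have pdF: "p - d \<in> F" using pX by (auto simp: X)
  obtain N where N: "N > 0" and slice: "\<And>R. \<exists>C\<ge>0. \<forall>u\<in>F. norm u \<le> R \<longrightarrow>
      (\<exists>u'\<in>F. T u' = T (p - d) \<and> norm (u - u') ^ N \<le> C * norm (T u - T (p - d)))"
    using holder_slice[OF T fam pdF] by blast
  obtain C where C: "C \<ge> 0" "\<And>u. u \<in> F \<Longrightarrow> norm u \<le> R + norm d \<Longrightarrow>
      \<exists>u'\<in>F. T u' = T (p - d) \<and> norm (u - u') ^ N \<le> C * norm (T u - T (p - d))"
    using slice by meson
  \<comment> \<open>\<open>sqrt (2 * b)\<close> comes from \<open>norm (S e)\<close> and
    \<open>sqrt (\<Phi> 0)\<close> from \<open>g \<bullet> e\<close>: the residual of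
    \<open>T\<close> is at most \<open>K * sqrt (\<Phi> k)\<close>. The \<open>N\<close>-th root of
    this square root gives \<open>\<theta>\<close>.\<close>
  define K where "K = sqrt (2 * b) + sqrt (\<Phi> 0)"
  define \<theta> where "\<theta> = 1 / (2 * real N)"
  define C' where "C' = L * (C * K) powr (1 / real N)"
  have K0: "K \<ge> 0" using b \<Phi>0 by (simp add: K_def)
  have \<theta>: "0 < \<theta>" "\<theta> \<le> 1" using N by (simp_all add: \<theta>_def)
  \<comment> \<open>By convexity the gap is at most the gradient at \<open>u\<close> paired with
    \<open>u\<close> minus a nearby minimiser; \<open>grad\<close> bounds this by the step times the
    distance, and the slice estimate bounds the distance by a power of the gap.\<close>
  have KL: "\<Phi> k \<le> C' * D k' * \<Phi> k powr \<theta>" if k: "k = Suc k'" for k k'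
  proof -
    define u where "u = x k"
    define e where "e = u - p"
    have "u - d \<in> F" using xX[of k] by (auto simp: X u_def)
    moreover have "norm (u - d) \<le> R + norm d"
      using bd[of k] norm_triangle_ineq4[of u d] by (simp add: u_def)
    ultimately obtain v where v: "v \<in> F" "T v = T (p - d)"
        "norm (u - d - v) ^ N \<le> C * norm (T (u - d) - T (p - d))"
      using C(2) by blast
    \<comment> \<open>Both summands are nonnegative, so the gap controls each separately.\<close>
    have \<Phi>e: "\<Phi> k = g \<bullet> e + S e \<bullet> e / 2"
      using expand[of u p] by (simp add: \<Phi>_def u_def e_def g_def)
    have ge: "0 \<le> g \<bullet> e" using VI[of u] xX[of k] by (simp add: e_def u_def)
    have "norm (S e) \<le> sqrt (2 * b) * sqrt (\<Phi> k)"
    proof -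
      have "(norm (S e))\<^sup>2 \<le> b * (S e \<bullet> e)" by (rule b(2))
      also have "\<dots> \<le> b * (2 * \<Phi> k)" using \<Phi>e ge b(1) by simp
      finally show ?thesis by (simp add: real_le_rsqrt mult_ac flip: real_sqrt_mult)
    qed
    moreover have "g \<bullet> e \<le> sqrt (\<Phi> 0) * sqrt (\<Phi> k)"
    proof -
      have "g \<bullet> e \<le> \<Phi> k" using \<Phi>e psd[of e] by simp
      also have "\<dots> = sqrt (\<Phi> k) * sqrt (\<Phi> k)" using \<Phi>0 by simp
      also have "\<dots> \<le> sqrt (\<Phi> 0) * sqrt (\<Phi> k)" using \<Phi>0 by (intro mult_right_mono) auto
      finally show ?thesis .
    qed
    moreover have "norm (T (u - d) - T (p - d)) \<le> norm (S e) + g \<bullet> e"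
    proof -
      have "T (u - d) - T (p - d) = (S e, g \<bullet> e)"
        by (simp add: T_def e_def linear_diff[OF S] inner_diff_right)
      then show ?thesis using norm_Pair_le[of "S e" "g \<bullet> e"] ge by simp
    qed
    ultimately have "norm (T (u - d) - T (p - d)) \<le> K * sqrt (\<Phi> k)"
      by (simp add: K_def distrib_right)
    then have "norm (u - d - v) ^ N \<le> C * (K * sqrt (\<Phi> k))"
      using v(3) C(1) by (meson mult_left_mono order_trans)
    then have "norm (u - d - v) \<le> (C * (K * sqrt (\<Phi> k))) powr (1 / real N)"
      using N by (intro le_powr_inverse) auto
    also have "\<dots> = (C * K) powr (1 / real N) * \<Phi> k powr \<theta>"
      using C(1) K0 \<Phi>0[of k]
      by (simp add: powr_mult powr_powr \<theta>_def mult.assoc flip: powr_half_sqrt)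
    finally have dist: "norm (u - (d + v)) \<le> (C * K) powr (1 / real N) * \<Phi> k powr \<theta>"
      by (simp add: diff_diff_eq)
    have vX: "d + v \<in> X" using v(1) by (simp add: X)
    have "T (d + v) = T p" using v(2) by (simp add: linear_add[OF T] linear_diff[OF T])
    then have "S (d + v - p) = 0" "g \<bullet> (d + v - p) = 0"
      by (simp_all add: T_def linear_diff[OF S] inner_diff_right)
    then have "f (d + v) = f p" using expand[of "d + v" p] by (simp add: g_def)
    moreover have "(S u - B) \<bullet> (u - (d + v)) = - ((S u - B) \<bullet> (d + v - u))"
      by (simp add: inner_diff_right)
    ultimately have "\<Phi> k \<le> (S u - B) \<bullet> (u - (d + v))"
      using expand[of "d + v" u] psd[of "d + v - u"] unfolding \<Phi>_def u_def by linarith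
    also have "\<dots> \<le> L * D k' * norm (u - (d + v))"
      using grad[OF vX, of k'] by (simp add: u_def D_def k)
    also have "\<dots> \<le> L * D k' * ((C * K) powr (1 / real N) * \<Phi> k powr \<theta>)"
      using dist L by (intro mult_left_mono) (auto simp: D_def)
    finally show ?thesis by (simp add: C'_def mult_ac)
  qed
  have "summable D"
  proof (rule summable_steps_of_descent)
    show "\<Phi> (Suc k) \<le> C' * D k * \<Phi> (Suc k) powr \<theta>" for k by (rule KL[OF refl])
    show "c * (D k)\<^sup>2 \<le> \<Phi> k - \<Phi> (Suc k)" for k using descent[of k] by (simp add: \<Phi>_def D_def)
  qed (use L c \<theta> \<Phi>0 in \<open>auto simp: D_def C'_def\<close>)
  then obtain q where q: "x \<longlonglongrightarrow> q"
    using convergent_of_summable_steps[of x] by (auto simp: D_def[abs_def])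
  have "p = q"
    using LIMSEQ_unique[OF lim LIMSEQ_subseq_LIMSEQ[OF q \<sigma>]] .
  then show ?thesis using q pX VI by (auto simp: g_def)
qed

section \<open>Gauss--Seidel iteration\<close>

lemma sum_split_at:
  fixes h :: "'r::{finite,linorder} \<Rightarrow> 'a::comm_monoid_add"
  shows "sum h UNIV = (\<Sum>t | t < l. h t) + h l + (\<Sum>t | l < t. h t)"
proof -
  have "UNIV = ({t. t < l} \<union> {l}) \<union> {t. l < t}" by auto
  then have "sum h UNIV = sum h (({t. t < l} \<union> {l}) \<union> {t. l < t})" by simp
  also have "\<dots> = sum h ({t. t < l} \<union> {l}) + (\<Sum>t | l < t. h t)"
    by (rule sum.union_disjoint) auto
  also have "sum h ({t. t < l} \<union> {l}) = (\<Sum>t | t < l. h t) + h l"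
    by (subst sum.union_disjoint) auto
  finally show ?thesis .
qed

lemma sum_below_eq_sum_above:
  fixes m :: "'r::{finite,linorder} \<Rightarrow> 'r \<Rightarrow> 'a::comm_monoid_add"
  assumes "\<And>s t. m s t = m t s"
  shows "(\<Sum>l\<in>UNIV. \<Sum>t | t < l. m t l) = (\<Sum>l\<in>UNIV. \<Sum>t | l < t. m t l)"
proof -
  have "(\<Sum>l\<in>UNIV. \<Sum>t | t < l. m t l) = (\<Sum>l\<in>UNIV. \<Sum>t\<in>UNIV. if t < l then m t l else 0)"
    by (simp add: sum.If_cases)
  also have "\<dots> = (\<Sum>t\<in>UNIV. \<Sum>l\<in>UNIV. if t < l then m t l else 0)"
    by (rule sum.swap)
  also have "\<dots> = (\<Sum>t\<in>UNIV. \<Sum>l | t < l. m l t)"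
    using assms by (simp add: sum.If_cases)
  finally show ?thesis .
qed

text \<open>Expanding the \<open>v t\<close> in an orthonormal basis turns the form into a sum of
  squared norms, one for each basis vector.\<close>

lemma gram_quadratic_form_nonneg:
  fixes u :: "'r::finite \<Rightarrow> 'c::real_inner" and v :: "'r \<Rightarrow> 'a::euclidean_space"
  shows "0 \<le> (\<Sum>l\<in>UNIV. (\<Sum>t\<in>UNIV. (u t \<bullet> u l) *\<^sub>R v t) \<bullet> v l)"
proof -
  define w where "w b = (\<Sum>t\<in>UNIV. (v t \<bullet> b) *\<^sub>R u t)" for b
  have "(\<Sum>l\<in>UNIV. (\<Sum>t\<in>UNIV. (u t \<bullet> u l) *\<^sub>R v t) \<bullet> v l)
      = (\<Sum>l\<in>UNIV. \<Sum>t\<in>UNIV. \<Sum>b\<in>Basis. (u t \<bullet> u l) * ((v t \<bullet> b) * (v l \<bullet> b)))"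
    by (simp add: inner_sum_left euclidean_inner[of "v _" "v _"] sum_distrib_left)
  also have "\<dots> = (\<Sum>l\<in>UNIV. \<Sum>b\<in>Basis. \<Sum>t\<in>UNIV. (u t \<bullet> u l) * ((v t \<bullet> b) * (v l \<bullet> b)))"
    by (intro sum.cong refl sum.swap)
  also have "\<dots> = (\<Sum>b\<in>Basis. \<Sum>l\<in>UNIV. \<Sum>t\<in>UNIV. (u t \<bullet> u l) * ((v t \<bullet> b) * (v l \<bullet> b)))"
    by (rule sum.swap)
  also have "\<dots> = (\<Sum>b\<in>Basis. w b \<bullet> w b)"
    by (simp add: w_def inner_sum_left inner_sum_right sum_distrib_left mult_ac)
  finally show ?thesis by (simp add: sum_nonneg)
qed

text \<open>\<open>gram\<close> makes the form positive semidefinite and turns a zero diagonal entry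
  into \<open>u l = 0\<close>; with \<open>B0\<close> the \<open>l\<close>-th equation is then
  vacuous. \<open>nonneg\<close> yields boundedness although \<open>A\<close> may be
  singular.\<close>

proposition gauss_seidel_converges:
  fixes A :: "real^'r::{finite,linorder}^'r::{finite,linorder}" and u :: "'r \<Rightarrow> 'c::real_inner"
    and B :: "'a::euclidean_space^'r::{finite,linorder}" and x :: "nat \<Rightarrow> 'a^'r::{finite,linorder}"
  assumes gram: "\<And>s t. A $ s $ t = u s \<bullet> u t"
    and B0: "\<And>l. u l = 0 \<Longrightarrow> B $ l = 0"
    and PD: "\<And>q. P q \<in> D" and proj: "\<And>q y. y \<in> D \<Longrightarrow> (q - P q) \<bullet> (y - P q) \<le> 0"
    and fam: "facially_regular \<F>" "K \<in> \<F>" and "closed K" and D: "D = (+) d ` K"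
    and iter: "\<And>k l. x (Suc k) $ l = P ((B $ l - (\<Sum>t | t < l. A $ t $ l *\<^sub>R x (Suc k) $ t)
                 - (\<Sum>t | l < t. A $ t $ l *\<^sub>R x k $ t)) /\<^sub>R A $ l $ l)"
    and nonneg: "\<And>s t. 0 \<le> A $ s $ t" "\<And>v w. v \<in> D \<Longrightarrow> w \<in> D \<Longrightarrow> 0 \<le> v \<bullet> w"
  shows "\<exists>p. (\<forall>l. p $ l \<in> D) \<and> x \<longlonglongrightarrow> p \<and>
     (\<forall>y. (\<forall>l. y $ l \<in> D) \<longrightarrow>
        0 \<le> (\<Sum>l\<in>UNIV. ((\<Sum>t\<in>UNIV. A $ t $ l *\<^sub>R p $ t) - B $ l) \<bullet> (y $ l - p $ l)))"
proof -
  have symA: "A $ s $ t = A $ t $ s" for s t by (simp add: gram inner_commute)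
  define S where "S v = (\<chi> l. \<Sum>t\<in>UNIV. A $ t $ l *\<^sub>R v $ t)" for v :: "'a^'r::{finite,linorder}"
  \<comment> \<open>The couplings that a sweep evaluates at old values; \<open>U\<close> of the step
    measures how far the end point is from satisfying all block conditions at once.\<close>
  define U where "U v = (\<chi> l. \<Sum>t | l < t. A $ t $ l *\<^sub>R v $ t)" for v :: "'a^'r::{finite,linorder}"
  have S: "linear S"
    by (rule linearI) (simp_all add: S_def vec_eq_iff scaleR_add_right sum.distrib scaleR_sum_right mult_ac)
  have U: "linear U"
    by (rule linearI) (simp_all add: U_def vec_eq_iff scaleR_add_right sum.distrib scaleR_sum_right mult_ac)
  have sym: "S v \<bullet> w = v \<bullet> S w" for v w
  proof -
    have "S v \<bullet> w = (\<Sum>l\<in>UNIV. \<Sum>t\<in>UNIV. A $ t $ l * (v $ t \<bullet> w $ l))"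
      by (simp add: S_def inner_vec_def inner_sum_left)
    also have "\<dots> = (\<Sum>t\<in>UNIV. \<Sum>l\<in>UNIV. A $ t $ l * (v $ t \<bullet> w $ l))" by (rule sum.swap)
    also have "\<dots> = v \<bullet> S w"
      by (simp add: S_def inner_vec_def inner_sum_right symA[of _ _])
    finally show ?thesis .
  qed
  have psd: "0 \<le> S v \<bullet> v" for v
    using gram_quadratic_form_nonneg[of u "\<lambda>t. v $ t"] by (simp add: S_def inner_vec_def gram)
  have quad: "S v \<bullet> v = 2 * (U v \<bullet> v) + (\<Sum>l\<in>UNIV. A $ l $ l * (v $ l \<bullet> v $ l))" for v
  proof -
    define m where "m t l = A $ t $ l * (v $ t \<bullet> v $ l)" for t l
    have m: "m s t = m t s" for s t by (simp add: m_def symA[of s] inner_commute)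
    have "S v \<bullet> v = (\<Sum>l\<in>UNIV. \<Sum>t\<in>UNIV. m t l)"
      by (simp add: S_def inner_vec_def inner_sum_left m_def)
    also have "\<dots> = (\<Sum>l\<in>UNIV. (\<Sum>t | t < l. m t l) + m l l + (\<Sum>t | l < t. m t l))"
      by (intro sum.cong refl sum_split_at)
    also have "\<dots> = 2 * (\<Sum>l\<in>UNIV. \<Sum>t | l < t. m t l) + (\<Sum>l\<in>UNIV. m l l)"
      using sum_below_eq_sum_above[OF m] by (simp add: sum.distrib)
    finally show ?thesis by (simp add: U_def inner_vec_def inner_sum_left m_def)
  qed
  define X where "X = {v :: 'a^'r::{finite,linorder}. \<forall>l. v $ l \<in> D}"
  define F where "F = {v :: 'a^'r::{finite,linorder}. \<forall>l. v $ l \<in> K}"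
  have F: "F \<in> {{v :: 'a^'r::{finite,linorder}. \<forall>l. v $ l \<in> Ks l} | Ks. \<forall>l. Ks l \<in> \<F>}"
    using fam(2) unfolding F_def by (intro CollectI exI[of _ "\<lambda>_. K"]) simp
  have "closed F" using \<open>closed K\<close> unfolding F_def
    by (intro closed_Collect_all closed_vimage[unfolded vimage_def] continuous_intros)
  have XF: "X = (+) (\<chi> l. d) ` F"
  proof (intro set_eqI iffI)
    fix v assume v: "v \<in> X"
    have "v $ l - d \<in> K" for l
    proof -
      have "v $ l \<in> (+) d ` K" using v by (simp add: X_def D)
      then show ?thesis by auto
    qed
    then have "v - (\<chi> l. d) \<in> F" by (simp add: F_def)
    then show "v \<in> (+) (\<chi> l. d) ` F" by (intro image_eqI[of _ _ "v - (\<chi> l. d)"]) auto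
  qed (auto simp: X_def F_def D)
  have "x (Suc k) $ l \<in> D" for k l by (subst iter) (rule PD)
  then have xX: "x (Suc k) \<in> X" for k by (simp add: X_def)
  \<comment> \<open>When block \<open>l\<close> is updated, the blocks after it are still old.
    Correcting the gradient at the end point by \<open>U\<close> of the step restores the block
    residual to which the projection inequality applies.\<close>
  have VI: "0 \<le> (S (x (Suc k)) - B - U (x (Suc k) - x k)) \<bullet> (y - x (Suc k))" if "y \<in> X" for k y
  proof -
    have "0 \<le> (S (x (Suc k)) - B - U (x (Suc k) - x k)) $ l \<bullet> (y $ l - x (Suc k) $ l)" for l
    proof -
      define r where "r = B $ l - (\<Sum>t | t < l. A $ t $ l *\<^sub>R x (Suc k) $ t)
                 - (\<Sum>t | l < t. A $ t $ l *\<^sub>R x k $ t)"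
      have Pr: "x (Suc k) $ l = P (r /\<^sub>R A $ l $ l)" unfolding r_def by (rule iter)
      have eq: "(S (x (Suc k)) - B - U (x (Suc k) - x k)) $ l = A $ l $ l *\<^sub>R x (Suc k) $ l - r"
        by (simp add: S_def U_def sum_split_at[of _ l] r_def scaleR_diff_right sum_subtractf)
      show ?thesis
      proof (cases "A $ l $ l = 0")
        \<comment> \<open>The update returns \<open>P 0\<close> here, but \<open>r\<close> and the
          corrected gradient component are both zero, so nothing is asked of it.\<close>
        case True
        then have "u l = 0" by (simp add: gram)
        then have "r = 0" using B0 by (simp add: r_def gram)
        then show ?thesis using eq True by simp
      next
        case False
        then have pos: "A $ l $ l > 0" by (simp add: gram order_less_le)
        have "(r /\<^sub>R A $ l $ l - x (Suc k) $ l) \<bullet> (y $ l - x (Suc k) $ l) \<le> 0"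
          using proj[of "y $ l" "r /\<^sub>R A $ l $ l"] that by (simp add: Pr X_def)
        then have "A $ l $ l * ((r /\<^sub>R A $ l $ l - x (Suc k) $ l) \<bullet> (y $ l - x (Suc k) $ l)) \<le> 0"
          using pos by (simp add: mult_le_0_iff)
        also have "A $ l $ l * ((r /\<^sub>R A $ l $ l - x (Suc k) $ l) \<bullet> (y $ l - x (Suc k) $ l))
            = (r - A $ l $ l *\<^sub>R x (Suc k) $ l) \<bullet> (y $ l - x (Suc k) $ l)"
          using pos by (simp add: scaleR_diff_right flip: inner_scaleR_left)
        finally show ?thesis unfolding eq by (simp add: inner_diff_left)
      qed
    qed
    then show ?thesis unfolding inner_vec_def by (auto intro: sum_nonneg)
  qed
  obtain L where L: "L > 0" "\<And>v. norm (U v) \<le> L * norm v"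
    using linear_bounded_pos[OF U] by blast
  \<comment> \<open>The \<open>1\<close> keeps the set nonempty when every diagonal entry
    vanishes.\<close>
  define c where "c = Min (insert 1 {A $ l $ l | l. A $ l $ l > 0}) / 2"
  have fin: "finite {A $ l $ l | l. A $ l $ l > 0}" by (rule finite_subset[of _ "range (\<lambda>l. A $ l $ l)"]) auto
  have c: "c > 0" using fin by (auto simp: c_def)
  have cl: "2 * c \<le> A $ l $ l" if "A $ l $ l > 0" for l
    using fin that by (auto simp: c_def intro!: Min_le)
  \<comment> \<open>Membership in \<open>X\<close> and the value \<open>P 0\<close> of blocks with
    zero diagonal entry are guaranteed only after the first sweep.\<close>
  define z where "z k = x (Suc k)" for k
  have step: "c * (norm (z (Suc k) - z k))\<^sup>2 \<le>
      (S (z k) \<bullet> z k / 2 - B \<bullet> z k) - (S (z (Suc k)) \<bullet> z (Suc k) / 2 - B \<bullet> z (Suc k))" for k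
  proof -
    define \<delta> where "\<delta> = z (Suc k) - z k"
    have zk: "z k = z (Suc k) - \<delta>" by (simp add: \<delta>_def)
    have \<delta>: "2 * c * (\<delta> $ l \<bullet> \<delta> $ l) \<le> A $ l $ l * (\<delta> $ l \<bullet> \<delta> $ l)" for l
    proof (cases "A $ l $ l = 0")
      case True
      then have "x (Suc j) $ l = P 0" for j using iter[of j l] by simp
      then have "\<delta> $ l = 0" by (simp add: \<delta>_def z_def)
      then show ?thesis by simp
    next
      case False
      then have "A $ l $ l > 0" by (simp add: gram order_less_le)
      then show ?thesis using cl by (intro mult_right_mono) auto
    qed
    have "2 * (c * (norm \<delta>)\<^sup>2) = (\<Sum>l\<in>UNIV. 2 * c * (\<delta> $ l \<bullet> \<delta> $ l))"
      by (simp add: power2_norm_eq_inner inner_vec_def sum_distrib_left mult_ac)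
    also have "\<dots> \<le> (\<Sum>l\<in>UNIV. A $ l $ l * (\<delta> $ l \<bullet> \<delta> $ l))"
      using \<delta> by (rule sum_mono)
    \<comment> \<open>By \<open>quad\<close> the diagonal is what remains of the form after removing
      both triangular parts. \<open>VI\<close>, tested at the previous iterate, bounds the
      first-order term by \<open>U \<delta> \<bullet> \<delta>\<close>, and half of this inequality
      is left as descent.\<close>
    finally have "2 * (c * (norm \<delta>)\<^sup>2) \<le> S \<delta> \<bullet> \<delta> - 2 * (U \<delta> \<bullet> \<delta>)" using quad[of \<delta>] by simp
    moreover have "0 \<le> (S (z (Suc k)) - B - U \<delta>) \<bullet> (- \<delta>)"
      using VI[OF xX[of k], of "Suc k"] by (simp add: z_def \<delta>_def)
    moreover have "S (z k) \<bullet> z k = S (z (Suc k)) \<bullet> z (Suc k) - 2 * (S (z (Suc k)) \<bullet> \<delta>) + S \<delta> \<bullet> \<delta>"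
      using sym[of \<delta> "z (Suc k)"]
      by (simp add: zk linear_diff[OF S] inner_diff_left inner_diff_right inner_commute[of \<delta>])
    moreover have "B \<bullet> z k = B \<bullet> z (Suc k) - B \<bullet> \<delta>" by (simp add: zk inner_diff_right)
    ultimately show ?thesis
      unfolding \<delta>_def[symmetric] inner_diff_left inner_minus_right by linarith
  qed
  have grad: "(S (z (Suc k)) - B) \<bullet> (z (Suc k) - y) \<le> L * norm (z (Suc k) - z k) * norm (z (Suc k) - y)"
    if "y \<in> X" for k y
  proof -
    define \<delta> where "\<delta> = z (Suc k) - z k"
    have "(S (z (Suc k)) - B) \<bullet> (z (Suc k) - y) \<le> U \<delta> \<bullet> (z (Suc k) - y)"
      using VI[OF that, of "Suc k"] by (simp add: z_def \<delta>_def inner_diff_left inner_diff_right)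
    also have "\<dots> \<le> norm (U \<delta>) * norm (z (Suc k) - y)" by (rule norm_cauchy_schwarz)
    also have "\<dots> \<le> L * norm \<delta> * norm (z (Suc k) - y)" by (intro mult_right_mono L) simp
    finally show ?thesis by (simp add: \<delta>_def)
  qed
  obtain R where bd: "\<And>k. norm (z k) \<le> R"
  proof -
    let ?f = "\<lambda>v. S v \<bullet> v / 2 - B \<bullet> v"
    have "?f (z (Suc k)) \<le> ?f (z k)" for k
      using step[of k] c by (smt (verit) mult_nonneg_nonneg zero_le_power2)
    then have dec: "?f (z k) \<le> ?f (z 0)" for k
      using lift_Suc_antimono_le[of "\<lambda>k. ?f (z k)" 0 k] by simp
    define q where "q l = norm (B $ l)" for l
    \<comment> \<open>Completing the square in every block makes all summands nonnegative, so a
      bound on the sum also bounds each block alone.\<close>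
    define C where "C = ?f (z 0) + (\<Sum>l\<in>UNIV. (q l)\<^sup>2 / (2 * A $ l $ l))"
    define T where "T l = max ((norm (P 0))\<^sup>2) (4 / A $ l $ l * (C + (q l)\<^sup>2 / A $ l $ l))" for l
    have "(norm (z k $ l))\<^sup>2 \<le> T l" for k l
    proof (cases "A $ l $ l = 0")
      case True
      then have "z k $ l = P 0" using iter[of k l] by (simp add: z_def)
      then show ?thesis by (simp add: T_def)
    next
      case False
      define s where "s t = norm (z k $ t)" for t
      have young: "0 \<le> A $ t $ t * (s t)\<^sup>2 / 2 - q t * s t + (q t)\<^sup>2 / (2 * A $ t $ t)" for t
      proof (cases "A $ t $ t = 0")
        case True
        then have "q t = 0" using B0[of t] by (simp add: gram q_def)
        then show ?thesis using True by simp
      next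
        case False
        then have "A $ t $ t > 0" using nonneg(1)[of t t] by simp
        moreover have "0 \<le> (A $ t $ t * s t - q t)\<^sup>2" by simp
        ultimately show ?thesis by (simp add: power2_eq_square field_simps)
      qed
      \<comment> \<open>Off-diagonal terms are nonnegative because points of \<open>D\<close> pair
        nonnegatively; this replaces coercivity of the form.\<close>
      have "(\<Sum>t\<in>UNIV. A $ t $ t * (s t)\<^sup>2) \<le> S (z k) \<bullet> z k"
      proof -
        have zD: "z k $ t \<in> D" for t using xX[of k] by (simp add: z_def X_def)
        have "S (z k) \<bullet> z k = (\<Sum>l\<in>UNIV. \<Sum>t\<in>UNIV. A $ t $ l * (z k $ t \<bullet> z k $ l))"
          by (simp add: S_def inner_vec_def inner_sum_left)
        also have "\<dots> \<ge> (\<Sum>l\<in>UNIV. A $ l $ l * (z k $ l \<bullet> z k $ l))"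
          using nonneg zD by (intro sum_mono member_le_sum) auto
        finally show ?thesis by (simp add: s_def power2_norm_eq_inner)
      qed
      moreover have "B \<bullet> z k \<le> (\<Sum>t\<in>UNIV. q t * s t)"
        unfolding inner_vec_def q_def s_def by (intro sum_mono norm_cauchy_schwarz)
      ultimately have "(\<Sum>t\<in>UNIV. A $ t $ t * (s t)\<^sup>2 / 2 - q t * s t) \<le> ?f (z 0)"
        using dec[of k] by (simp add: sum_subtractf flip: sum_divide_distrib)
      then have "(\<Sum>t\<in>UNIV. A $ t $ t * (s t)\<^sup>2 / 2 - q t * s t + (q t)\<^sup>2 / (2 * A $ t $ t)) \<le> C"
        by (simp add: C_def sum.distrib)
      moreover have "A $ l $ l * (s l)\<^sup>2 / 2 - q l * s l + (q l)\<^sup>2 / (2 * A $ l $ l)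
          \<le> (\<Sum>t\<in>UNIV. A $ t $ t * (s t)\<^sup>2 / 2 - q t * s t + (q t)\<^sup>2 / (2 * A $ t $ t))"
        using young by (intro member_le_sum) auto
      ultimately have upper: "A $ l $ l * (s l)\<^sup>2 / 2 - q l * s l + (q l)\<^sup>2 / (2 * A $ l $ l) \<le> C" by linarith
      have pos: "A $ l $ l > 0" using False nonneg(1)[of l l] by simp
      have "0 \<le> (A $ l $ l * s l - 2 * q l)\<^sup>2" by simp
      with pos have "q l * s l \<le> A $ l $ l * (s l)\<^sup>2 / 4 + (q l)\<^sup>2 / A $ l $ l"
        by (simp add: power2_eq_square field_simps)
      moreover have "0 \<le> (q l)\<^sup>2 / (2 * A $ l $ l)" using pos by simp
      ultimately have "A $ l $ l * (s l)\<^sup>2 / 4 \<le> C + (q l)\<^sup>2 / A $ l $ l" using upper by linarith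
      then have "(s l)\<^sup>2 \<le> 4 / A $ l $ l * (C + (q l)\<^sup>2 / A $ l $ l)"
        using pos by (simp add: field_simps)
      then show ?thesis by (simp add: T_def s_def)
    qed
    then have "(norm (z k))\<^sup>2 \<le> sum T UNIV" for k
      unfolding power2_norm_eq_inner inner_vec_def by (intro sum_mono)
    then have "norm (z k) \<le> sqrt (sum T UNIV)" for k by (intro real_le_rsqrt)
    then show ?thesis by (rule that)
  qed
  have "\<exists>p\<in>X. z \<longlonglongrightarrow> p \<and> (\<forall>y\<in>X. 0 \<le> (S p - B) \<bullet> (y - p))"
  proof (rule quadratic_descent_converges[OF S sym psd facially_regular_product[OF fam(1)] F
          \<open>closed F\<close> XF])
    show "norm (z k) \<le> R" for k by (rule bd)
    show "0 \<le> L" using L by simp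
  qed (fact c step grad xX[folded z_def])+
  then obtain p where p: "p \<in> X" "z \<longlonglongrightarrow> p" "\<And>y. y \<in> X \<Longrightarrow> 0 \<le> (S p - B) \<bullet> (y - p)"
    by blast
  have "x \<longlonglongrightarrow> p" using p(2) by (simp add: z_def[abs_def] filterlim_sequentially_Suc)
  with p(1,3) show ?thesis
    by (intro exI[of _ p]) (auto simp: X_def S_def inner_vec_def)
qed

section \<open>Quaternion cones and projections\<close>

lemma closed_second_order_cone: "closed (second_order_cone e)"
  unfolding second_order_cone_def by (intro closed_Collect_le continuous_intros)

lemma closed_coordinate_cone: "closed (coordinate_cone I)"
proof -
  have "coordinate_cone I = (\<Inter>b\<in>Basis. if b \<in> I then {x. 0 \<le> x \<bullet> b} else {x. x \<bullet> b = 0})"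
    by (auto simp: coordinate_cone_def)
  also have "closed \<dots>"
    by (intro closed_INT ballI) (auto intro!: closed_Collect_le closed_Collect_eq continuous_intros)
  finally show ?thesis .
qed

lemma norm_one_quat: "norm (1 :: quat) = 1"
  by (simp add: norm_quat_def one_quat_def)

lemma H_S_iff: "q \<in> H_S \<longleftrightarrow> norm (qIm q) \<le> qre q"
proof -
  have "norm (qIm q) \<le> qre q \<longleftrightarrow> 0 \<le> qre q \<and> (norm (qIm q))\<^sup>2 \<le> (qre q)\<^sup>2"
    using norm_ge_zero[of "qIm q"] by (metis order_trans power2_le_imp_le power_mono)
  then show ?thesis by (simp add: H_S_def)
qed

lemma H_S_eq_second_order_cone: "H_S = second_order_cone 1"
proof -
  have "q - (q \<bullet> 1) *\<^sub>R 1 = qIm q" "q \<bullet> 1 = qre q" for q :: quat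
    by (simp_all add: qIm_def quat_ring_defs inner_quat_def)
  then show ?thesis by (auto simp: H_S_iff second_order_cone_def)
qed

text \<open>Needed twice: for the iterates of HNLS-WQ and for the Gram entries of \<open>W\<close>
  in HNLS-HR.\<close>

lemma H_S_inner_nonneg:
  assumes "p \<in> H_S" "q \<in> H_S"
  shows "0 \<le> p \<bullet> q"
proof -
  have "- (qIm p \<bullet> qIm q) \<le> norm (qIm p) * norm (qIm q)"
    using norm_cauchy_schwarz[of "- qIm p" "qIm q"] by simp
  also have "\<dots> \<le> qre p * qre q"
  proof (rule mult_mono)
    show "0 \<le> qre p" using assms(1) by (simp add: H_S_def)
  qed (use assms in \<open>simp_all add: H_S_iff\<close>)
  finally show ?thesis by (simp add: inner_quat_def qIm_def)
qed

lemma H_pure_eq_coordinate_cone: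
  "H_pure = coordinate_cone {Quat 0 1 0 0, Quat 0 0 1 0, Quat 0 0 0 1}"
  by (auto simp: H_pure_def coordinate_cone_def Basis_quat_def inner_quat_def)

lemma H_pure_floor_eq_translate:
  "H_pure_floor \<xi> = (+) (Quat 0 (\<xi>/2) (\<xi>/2) (\<xi>/2)) ` H_pure"
proof (intro set_eqI iffI)
  fix q assume "q \<in> H_pure_floor \<xi>"
  then show "q \<in> (+) (Quat 0 (\<xi>/2) (\<xi>/2) (\<xi>/2)) ` H_pure"
    by (intro image_eqI[of _ _ "q - Quat 0 (\<xi>/2) (\<xi>/2) (\<xi>/2)"])
       (auto simp: H_pure_def H_pure_floor_def quat_ring_defs quat_eq_iff)
qed (auto simp: H_pure_def H_pure_floor_def quat_ring_defs)

lemma atLeast_eq_translate: "{\<xi>..} = (+) (\<xi>::real) ` coordinate_cone {1}"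
proof -
  have "coordinate_cone {1} = {0 :: real..}" by (auto simp: coordinate_cone_def)
  then show ?thesis by simp
qed

lemma proj_pure_in: "proj_pure \<xi> q \<in> H_pure_floor \<xi>"
  by (simp add: proj_pure_def H_pure_floor_def scaleR_quat_def)

text \<open>As \<open>\<xi> > 0\<close>, each imaginary component is mapped to its maximum with
  \<open>\<xi> / 2\<close>, so the claim splits into three one-dimensional ones.\<close>

lemma proj_pure_obtuse:
  assumes "\<xi> > 0" "y \<in> H_pure_floor \<xi>"
  shows "(q - proj_pure \<xi> q) \<bullet> (y - proj_pure \<xi> q) \<le> 0"
proof -
  have real: "(x - max \<xi> (\<bar>x\<bar> + x) / 2) * (z - max \<xi> (\<bar>x\<bar> + x) / 2) \<le> 0" if "\<xi> / 2 \<le> z" for x z :: real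
  proof (cases "\<xi> / 2 \<le> x")
    case True
    then have "max \<xi> (\<bar>x\<bar> + x) = 2 * x" using assms(1) by auto
    then show ?thesis by simp
  next
    case False
    then have "max \<xi> (\<bar>x\<bar> + x) = \<xi>" using assms(1) by auto
    then show ?thesis using False that by (simp add: mult_le_0_iff)
  qed
  show ?thesis
    using real[of "qi y" "qi q"] real[of "qj y" "qj q"] real[of "qk y" "qk q"] assms(2)
    by (simp add: H_pure_floor_def proj_pure_def inner_quat_def scaleR_quat_def minus_quat_def)
qed

text \<open>The real-linear inverse of \<^const>\<open>J_of\<close> on Hermitian matrices. It carries the positive
  semidefinite matrices to \<^const>\<open>H_S\<close> and the trace form to a multiple of the inner product.\<close>

definition quat_of_matrix :: "complex^2^2 \<Rightarrow> quat" where
  "quat_of_matrix A = Quat (Re (A $ 1 $ 1) + Re (A $ 2 $ 2)) (2 * Im (A $ 1 $ 2))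
     (Re (A $ 1 $ 1) - Re (A $ 2 $ 2)) (2 * Re (A $ 1 $ 2))"

definition outer_self :: "complex^2 \<Rightarrow> complex^2^2" where
  "outer_self v = (\<chi> i j. v $ i * cnj (v $ j))"

lemma quat_of_matrix_J_of: "quat_of_matrix (J_of q) = q"
  by (cases q) (simp add: quat_of_matrix_def J_of_def field_simps)

lemma quat_of_matrix_combination:
  "quat_of_matrix (\<Sum>t\<in>UNIV. \<chi> i j. of_real (h t) * (u t $ i * cnj (u t $ j)))
     = (\<Sum>t\<in>(UNIV :: 2 set). h t *\<^sub>R quat_of_matrix (outer_self (u t)))"
  by (simp add: sum_2 quat_of_matrix_def outer_self_def quat_ring_defs algebra_simps)

text \<open>This is the Hopf map: the imaginary part has the same norm as the real part, so the
  point lies on the boundary of the cone.\<close>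

lemma quat_of_outer_self_in_H_S: "quat_of_matrix (outer_self v) \<in> H_S"
proof -
  let ?a = "(Re (v $ 1))\<^sup>2 + (Im (v $ 1))\<^sup>2" and ?b = "(Re (v $ 2))\<^sup>2 + (Im (v $ 2))\<^sup>2"
  let ?q = "quat_of_matrix (outer_self v)"
  have re: "qre ?q = ?a + ?b"
    by (simp add: quat_of_matrix_def outer_self_def power2_eq_square)
  have "(norm (qIm ?q))\<^sup>2 = (?a + ?b)\<^sup>2"
    by (simp add: norm_quat_def qIm_def quat_of_matrix_def outer_self_def)
       (simp add: power2_eq_square algebra_simps)
  then show ?thesis by (simp add: H_S_def re)
qed

lemma quat_of_outer_self_orthogonal:
  assumes "(\<Sum>i\<in>UNIV. cnj (v $ i) * w $ i) = 0"
  shows "quat_of_matrix (outer_self v) \<bullet> quat_of_matrix (outer_self w) = 0"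
proof -
  have "quat_of_matrix (outer_self v) \<bullet> quat_of_matrix (outer_self w)
      = 2 * (cmod (\<Sum>i\<in>UNIV. cnj (v $ i) * w $ i))\<^sup>2"
    by (simp add: quat_of_matrix_def outer_self_def inner_quat_def sum_2 cmod_power2)
       (simp add: power2_eq_square algebra_simps)
  with assms show ?thesis by simp
qed

section \<open>Spectral decomposition and the projection onto \<open>H_S\<close>\<close>

lemma eigensystem_decomposition:
  assumes "orthonormal_eigensystem J \<eta> u"
  shows "J = (\<Sum>t\<in>UNIV. \<chi> i j. of_real (\<eta> t) * (u t $ i * cnj (u t $ j)))"
proof -
  have on: "(\<Sum>i\<in>UNIV. cnj (u s $ i) * u t $ i) = (if s = t then 1 else 0)" for s t
    using assms by (simp add: orthonormal_eigensystem_def)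
  have eig: "(\<Sum>k\<in>UNIV. J $ i $ k * u t $ k) = of_real (\<eta> t) * u t $ i" for t i
    using assms by (simp add: orthonormal_eigensystem_def vec_eq_iff matrix_vector_mult_def)
  define U :: "complex^2^2" where "U = (\<chi> i t. u t $ i)"
  define V :: "complex^2^2" where "V = (\<chi> t i. cnj (u t $ i))"
  \<comment> \<open>Orthonormality gives a left inverse; for square matrices it is also a right
    inverse, which is the resolution of the identity \<open>compl\<close>.\<close>
  have "V ** U = mat 1"
    by (simp add: vec_eq_iff matrix_matrix_mult_def U_def V_def on mat_def)
  then have "U ** V = mat 1" by (simp add: matrix_left_right_inverse)
  then have compl: "(\<Sum>t\<in>UNIV. u t $ k * cnj (u t $ j)) = (if k = j then 1 else 0)" for k j
    by (auto simp: vec_eq_iff matrix_matrix_mult_def U_def V_def mat_def)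
  have "J $ i $ j = (\<Sum>t\<in>UNIV. of_real (\<eta> t) * (u t $ i * cnj (u t $ j)))" for i j
  proof -
    have "J $ i $ j = (\<Sum>k\<in>UNIV. J $ i $ k * (\<Sum>t\<in>UNIV. u t $ k * cnj (u t $ j)))"
      using exhaust_2[of j] by (auto simp: compl sum_2)
    also have "\<dots> = (\<Sum>t\<in>UNIV. (\<Sum>k\<in>UNIV. J $ i $ k * u t $ k) * cnj (u t $ j))"
      by (simp add: sum_2 algebra_simps)
    finally show ?thesis by (simp add: eig mult.assoc)
  qed
  then show ?thesis by (simp add: vec_eq_iff)
qed

text \<open>Ensures that \<open>SOME\<close> in \<open>psd_part\<close> picks a genuine
  decomposition. The diagonal case is separate because there one of the vectors
  \<open>(c, d t)\<close> vanishes.\<close>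

lemma orthonormal_eigensystem_exists: "\<exists>\<eta> u. orthonormal_eigensystem (J_of q) \<eta> u"
proof -
  define a b c where "a = (qre q + qj q) / 2" and "b = (qre q - qj q) / 2"
    and "c = Complex (qk q / 2) (qi q / 2)"
  have J: "J_of q $ 1 $ 1 = of_real a" "J_of q $ 1 $ 2 = c" "J_of q $ 2 $ 1 = cnj c"
      "J_of q $ 2 $ 2 = of_real b"
    by (simp_all add: J_of_def a_def b_def c_def complex_eq_iff)
  show ?thesis
  proof (cases "c = 0")
    case True
    then have "orthonormal_eigensystem (J_of q) (\<lambda>t. if t = 1 then a else b) (\<lambda>t. axis t 1)"
      by (simp add: orthonormal_eigensystem_def forall_2 sum_2 vec_eq_iff matrix_vector_mult_def
          axis_def J)
    then show ?thesis by blast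
  next
    case False
    \<comment> \<open>The differences \<open>\<eta> t - a\<close> are the roots \<open>d 1\<close>, \<open>d 2\<close> of \<open>x (x + a - b) = |c|^2\<close>, and
      \<open>(c, d t)\<close> is an eigenvector.\<close>
    define \<rho> where "\<rho> = sqrt ((a - b)\<^sup>2 / 4 + (cmod c)\<^sup>2)"
    define d :: "2 \<Rightarrow> real" where "d t = (b - a) / 2 + (if t = 1 then \<rho> else - \<rho>)" for t
    define n where "n t = sqrt ((cmod c)\<^sup>2 + (d t)\<^sup>2)" for t
    define u :: "2 \<Rightarrow> complex^2" where "u t = vector [c / of_real (n t), of_real (d t / n t)]" for t
    have \<rho>2: "\<rho>\<^sup>2 = (a - b)\<^sup>2 / 4 + (cmod c)\<^sup>2" by (simp add: \<rho>_def)
    have n2: "(n t)\<^sup>2 = (cmod c)\<^sup>2 + (d t)\<^sup>2" for t by (simp add: n_def)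
    have n0: "n t \<noteq> 0" for t using False by (simp add: n_def add_nonneg_eq_0_iff)
    have root: "d t * (d t + a - b) = (cmod c)\<^sup>2" for t
      using \<rho>2 by (simp add: d_def power2_eq_square field_simps)
    have prod: "d 1 * d 2 = - (cmod c)\<^sup>2"
      using \<rho>2 by (simp add: d_def power2_eq_square field_simps)
    have cc: "cnj c * c = of_real ((cmod c)\<^sup>2)" "c * cnj c = of_real ((cmod c)\<^sup>2)"
      by (simp_all only: complex_norm_square mult.commute[of "cnj c"])
    have dot: "(\<Sum>i\<in>UNIV. cnj (u s $ i) * u t $ i) = of_real (((cmod c)\<^sup>2 + d s * d t) / (n s * n t))" for s t
    proof -
      have "(\<Sum>i\<in>UNIV. cnj (u s $ i) * u t $ i)
          = (cnj c * c) / (of_real (n s) * of_real (n t)) + of_real (d s * d t / (n s * n t))"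
        by (simp add: sum_2 u_def)
      then show ?thesis unfolding cc by (simp add: add_divide_distrib)
    qed
    have "(\<Sum>i\<in>UNIV. cnj (u s $ i) * u t $ i) = (if s = t then 1 else 0)" for s t
    proof (cases "s = t")
      case True
      have "(cmod c)\<^sup>2 + d t * d t = n t * n t"
        using n2[of t] by (simp add: power2_eq_square)
      then show ?thesis unfolding dot using True n0[of t] by simp
    next
      case False
      then have "d s * d t = d 1 * d 2"
        using exhaust_2[of s] exhaust_2[of t] by (auto simp: mult.commute)
      then show ?thesis unfolding dot using False prod by simp
    qed
    moreover have "J_of q *v u t = of_real (a + d t) *s u t" for t
    proof -
      have "cnj c * c = of_real (d t) * (of_real (d t) + of_real a - of_real b)"
        unfolding cc root[of t, symmetric] by simp
      then show ?thesis using n0[of t]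
        by (simp add: vec_eq_iff forall_2 matrix_vector_mult_def sum_2 J u_def field_simps)
    qed
    ultimately have "orthonormal_eigensystem (J_of q) (\<lambda>t. a + d t) u"
      by (simp add: orthonormal_eigensystem_def)
    then show ?thesis by blast
  qed
qed

text \<open>The rank-one spectral projections become an orthogonal frame in \<open>H_S\<close>, in
  which \<open>q\<close> and its image differ only in the coefficients. The frame comes from
  whichever eigensystem \<open>SOME\<close> selects, so uniqueness of the choice never has to be
  shown.\<close>

lemma proj_S_decomposition:
  obtains \<eta> :: "2 \<Rightarrow> real" and p :: "2 \<Rightarrow> quat" where
    "q = (\<Sum>t\<in>UNIV. \<eta> t *\<^sub>R p t)" "proj_S q = (\<Sum>t\<in>UNIV. max 0 (\<eta> t) *\<^sub>R p t)"
    "\<forall>t. p t \<in> H_S" "p 1 \<bullet> p 2 = 0"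
proof -
  have "\<exists>P \<eta> u. orthonormal_eigensystem (J_of q) \<eta> u \<and>
     P = (\<Sum>t\<in>UNIV. \<chi> i j. of_real (max 0 (\<eta> t)) * (u t $ i * cnj (u t $ j)))"
    using orthonormal_eigensystem_exists[of q] by blast
  from someI_ex[OF this] obtain \<eta> u where eig: "orthonormal_eigensystem (J_of q) \<eta> u"
    and psd: "psd_part (J_of q) = (\<Sum>t\<in>UNIV. \<chi> i j. of_real (max 0 (\<eta> t)) * (u t $ i * cnj (u t $ j)))"
    unfolding psd_part_def by blast
  define p where "p t = quat_of_matrix (outer_self (u t))" for t
  have "q = quat_of_matrix (J_of q)" by (simp add: quat_of_matrix_J_of)
  also have "\<dots> = (\<Sum>t\<in>UNIV. \<eta> t *\<^sub>R p t)"
    unfolding p_def quat_of_matrix_combination[symmetric] by (subst eigensystem_decomposition[OF eig]) (rule refl)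
  finally have "q = (\<Sum>t\<in>UNIV. \<eta> t *\<^sub>R p t)" .
  moreover have "proj_S q = quat_of_matrix (psd_part (J_of q))"
    by (simp add: proj_S_def quat_of_matrix_def Let_def)
  then have "proj_S q = (\<Sum>t\<in>UNIV. max 0 (\<eta> t) *\<^sub>R p t)"
    unfolding p_def psd quat_of_matrix_combination .
  moreover have "\<forall>t. p t \<in> H_S" by (simp add: p_def quat_of_outer_self_in_H_S)
  moreover have "p 1 \<bullet> p 2 = 0"
    unfolding p_def using eig
    by (intro quat_of_outer_self_orthogonal) (simp add: orthonormal_eigensystem_def)
  ultimately show ?thesis by (rule that)
qed

lemma convex_cone_H_S:
  shows "p \<in> H_S \<Longrightarrow> q \<in> H_S \<Longrightarrow> p + q \<in> H_S" and "p \<in> H_S \<Longrightarrow> 0 \<le> t \<Longrightarrow> t *\<^sub>R p \<in> H_S"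
proof -
  have "H_S \<in> insert (second_order_cone 1) (range ray)" by (simp add: H_S_eq_second_order_cone)
  from facially_regularD[OF facially_regular_second_order_cone[OF norm_one_quat] this]
  have "convex H_S" "cone H_S" by auto
  then show "p \<in> H_S \<Longrightarrow> q \<in> H_S \<Longrightarrow> p + q \<in> H_S" "p \<in> H_S \<Longrightarrow> 0 \<le> t \<Longrightarrow> t *\<^sub>R p \<in> H_S"
    using convex_cone[of H_S] by blast+
qed

lemma proj_S_in: "proj_S q \<in> H_S"
proof -
  obtain \<eta> :: "2 \<Rightarrow> real" and p where "q = (\<Sum>t\<in>UNIV. \<eta> t *\<^sub>R p t)"
    "proj_S q = (\<Sum>t\<in>UNIV. max 0 (\<eta> t) *\<^sub>R p t)" "\<forall>t. p t \<in> H_S" "p 1 \<bullet> p 2 = 0"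
    by (rule proj_S_decomposition[of q])
  then show ?thesis by (simp add: sum_2 convex_cone_H_S)
qed

text \<open>Moreau decomposition: \<open>q - proj_S q\<close> carries the negative coefficients, is
  orthogonal to \<open>proj_S q\<close>, and pairs nonpositively with \<open>H_S\<close> by
  self-duality.\<close>

lemma proj_S_obtuse:
  assumes y: "y \<in> H_S"
  shows "(q - proj_S q) \<bullet> (y - proj_S q) \<le> 0"
proof -
  obtain \<eta> :: "2 \<Rightarrow> real" and p where q: "q = (\<Sum>t\<in>UNIV. \<eta> t *\<^sub>R p t)" "proj_S q = (\<Sum>t\<in>UNIV. max 0 (\<eta> t) *\<^sub>R p t)"
    and p: "\<forall>t. p t \<in> H_S" "p 1 \<bullet> p 2 = 0"
    by (rule proj_S_decomposition[of q])
  have "q - proj_S q = (\<Sum>t\<in>UNIV. min 0 (\<eta> t) *\<^sub>R p t)"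
    by (subst q(1), subst q(2)) (simp add: sum_2 min_def max_def)
  then have "(q - proj_S q) \<bullet> (y - proj_S q) = min 0 (\<eta> 1) * (p 1 \<bullet> y) + min 0 (\<eta> 2) * (p 2 \<bullet> y)
      - (max 0 (\<eta> 1) * min 0 (\<eta> 1) * (p 1 \<bullet> p 1) + max 0 (\<eta> 2) * min 0 (\<eta> 2) * (p 2 \<bullet> p 2))"
    using p(2) by (simp add: q(2) sum_2 inner_diff_right inner_add_left inner_add_right
        inner_commute[of "p 2" "p 1"])
  moreover have "min 0 (\<eta> t) * (p t \<bullet> y) \<le> 0" for t
    using H_S_inner_nonneg[OF p(1)[rule_format] y, of t] by (simp add: mult_le_0_iff)
  moreover have "max 0 (\<eta> t) * min 0 (\<eta> t) = 0" for t by (simp add: min_def max_def)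
  ultimately show ?thesis by (simp only: mult_zero_left add_nonpos_nonpos add_0_right diff_zero)
qed

section \<open>Least squares with quaternion matrices\<close>

lemma frobenius_sq_eq_norm: "frobenius_sq Q = (norm Q)\<^sup>2"
  by (simp add: frobenius_sq_def power2_norm_eq_inner inner_vec_def)

lemma stationary_point_least_squares:
  fixes T :: "'a::euclidean_space \<Rightarrow> quat^'n^'m"
  assumes T: "linear T" and "p \<in> C"
    and VI: "\<And>y. y \<in> C \<Longrightarrow> 0 \<le> (T p - M) \<bullet> T (y - p)"
  shows "stationary_point (\<lambda>X. frobenius_sq (M - T X)) C p"
proof -
  define g where "g = 2 *\<^sub>R adjoint T (T p - M)"
  have g: "h \<bullet> g = 2 * ((T p - M) \<bullet> T h)" for h
    using adjoint_works[OF T, of h "T p - M"] by (simp add: g_def inner_commute)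
  have "(T has_derivative T) (at p)"
    using T by (intro bounded_linear_imp_has_derivative) (simp add: linear_conv_bounded_linear)
  then have "((\<lambda>X. (M - T X) \<bullet> (M - T X)) has_derivative
      (\<lambda>h. (M - T p) \<bullet> (0 - T h) + (0 - T h) \<bullet> (M - T p))) (at p)"
    by (intro derivative_intros)
  moreover have "(M - T p) \<bullet> (0 - T h) + (0 - T h) \<bullet> (M - T p) = h \<bullet> g" for h
    unfolding g by (simp add: inner_diff_left inner_diff_right inner_commute)
  ultimately have "GDERIV (\<lambda>X. frobenius_sq (M - T X)) p :> g"
    by (simp add: gderiv_def frobenius_sq_eq_norm power2_norm_eq_inner)
  moreover have "0 \<le> g \<bullet> (y - p)" if "y \<in> C" for y
    using VI[OF that] g[of "y - p"] by (simp add: inner_commute)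
  ultimately show ?thesis using \<open>p \<in> C\<close> by (auto simp: stationary_point_def)
qed

lemma quat_times_of_real: "(q :: quat) * of_real t = t *\<^sub>R q"
  by (simp add: of_real_def)

lemma matrix_mult_qmat_of_real:
  "(X ** qmat_of_real H) $ i $ j = (\<Sum>l\<in>UNIV. H $ l $ j *\<^sub>R X $ i $ l)"
  by (simp add: matrix_matrix_mult_def qmat_of_real_def quat_times_of_real)

lemma linear_matrix_mult_left: "linear (\<lambda>X. X ** qmat_of_real H)"
  by (rule linearI)
     (simp_all add: vec_eq_iff matrix_mult_qmat_of_real scaleR_add_right sum.distrib scaleR_sum_right mult.commute)

lemma linear_matrix_mult_right: "linear (\<lambda>Y. W ** qmat_of_real Y)"
  by (rule linearI)
     (simp_all add: vec_eq_iff matrix_mult_qmat_of_real scaleR_add_left sum.distrib scaleR_sum_right)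

text \<open>Normal equations for one row: collecting the terms by \<open>e l\<close> replaces the
  sum over the data by Gram matrix and right-hand side, the form in which
  \<open>gauss_seidel_converges\<close> states its inequality.\<close>

lemma residual_inner_row:
  fixes h :: "real^'n^'r" and v e :: "'r \<Rightarrow> 'a::real_inner" and m :: "'n \<Rightarrow> 'a"
  shows "(\<Sum>j\<in>UNIV. ((\<Sum>t\<in>UNIV. h $ t $ j *\<^sub>R v t) - m j) \<bullet> (\<Sum>l\<in>UNIV. h $ l $ j *\<^sub>R e l))
    = (\<Sum>l\<in>UNIV. ((\<Sum>t\<in>UNIV. (h $ t \<bullet> h $ l) *\<^sub>R v t) - (\<Sum>j\<in>UNIV. h $ l $ j *\<^sub>R m j)) \<bullet> e l)"
proof -
  have gram: "(\<Sum>t\<in>UNIV. (h $ t \<bullet> h $ l) *\<^sub>R v t) = (\<Sum>j\<in>UNIV. h $ l $ j *\<^sub>R (\<Sum>t\<in>UNIV. h $ t $ j *\<^sub>R v t))" for l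
    unfolding scaleR_sum_right
    by (subst sum.swap) (simp add: inner_vec_def scaleR_sum_left mult.commute)
  have "(\<Sum>j\<in>UNIV. ((\<Sum>t\<in>UNIV. h $ t $ j *\<^sub>R v t) - m j) \<bullet> (\<Sum>l\<in>UNIV. h $ l $ j *\<^sub>R e l))
     = (\<Sum>j\<in>UNIV. \<Sum>l\<in>UNIV. h $ l $ j *\<^sub>R ((\<Sum>t\<in>UNIV. h $ t $ j *\<^sub>R v t) - m j) \<bullet> e l)"
    by (simp add: inner_sum_right)
  also have "\<dots> = (\<Sum>l\<in>UNIV. \<Sum>j\<in>UNIV. h $ l $ j *\<^sub>R ((\<Sum>t\<in>UNIV. h $ t $ j *\<^sub>R v t) - m j) \<bullet> e l)"
    by (rule sum.swap)
  also have "\<dots> = (\<Sum>l\<in>UNIV. (\<Sum>j\<in>UNIV. h $ l $ j *\<^sub>R ((\<Sum>t\<in>UNIV. h $ t $ j *\<^sub>R v t) - m j)) \<bullet> e l)"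
    by (simp add: inner_sum_left)
  finally show ?thesis by (simp add: gram scaleR_diff_right sum_subtractf)
qed

text \<open>The counterpart with real unknowns and quaternion coefficients.\<close>

lemma residual_inner_column:
  fixes w :: "'r::finite \<Rightarrow> 'm::finite \<Rightarrow> 'a::real_inner" and v e :: "'r::finite \<Rightarrow> real" and m :: "'m::finite \<Rightarrow> 'a"
  shows "(\<Sum>i\<in>UNIV. ((\<Sum>t\<in>UNIV. v t *\<^sub>R w t i) - m i) \<bullet> (\<Sum>l\<in>UNIV. e l *\<^sub>R w l i))
    = (\<Sum>l\<in>UNIV. ((\<Sum>t\<in>UNIV. (\<Sum>i\<in>UNIV. w t i \<bullet> w l i) * v t) - (\<Sum>i\<in>UNIV. w l i \<bullet> m i)) * e l)"
proof -
  have gram: "(\<Sum>t\<in>UNIV. (\<Sum>i\<in>UNIV. w t i \<bullet> w l i) * v t) = (\<Sum>i\<in>UNIV. (\<Sum>t\<in>UNIV. v t *\<^sub>R w t i) \<bullet> w l i)" for l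
    unfolding inner_sum_left
    by (subst sum.swap) (simp add: sum_distrib_left mult.commute)
  have "(\<Sum>i\<in>UNIV. ((\<Sum>t\<in>UNIV. v t *\<^sub>R w t i) - m i) \<bullet> (\<Sum>l\<in>UNIV. e l *\<^sub>R w l i))
     = (\<Sum>i\<in>UNIV. \<Sum>l\<in>UNIV. (((\<Sum>t\<in>UNIV. v t *\<^sub>R w t i) - m i) \<bullet> w l i) * e l)"
    by (simp add: inner_sum_right mult.commute)
  also have "\<dots> = (\<Sum>l\<in>UNIV. \<Sum>i\<in>UNIV. (((\<Sum>t\<in>UNIV. v t *\<^sub>R w t i) - m i) \<bullet> w l i) * e l)"
    by (rule sum.swap)
  also have "\<dots> = (\<Sum>l\<in>UNIV. (\<Sum>i\<in>UNIV. ((\<Sum>t\<in>UNIV. v t *\<^sub>R w t i) - m i) \<bullet> w l i) * e l)"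
    by (simp add: sum_distrib_right)
  finally show ?thesis by (simp add: gram inner_diff_left sum_subtractf inner_commute[of "m _"])
qed

section \<open>Assembly of the limits over the rows of \<open>W\<close> and the columns of
  \<open>H\<close>\<close>

lemma HNLS_WQ_converges:
  fixes M :: "quat^'n^'m" and H :: "real^'n^'r::{finite,linorder}"
    and W :: "nat \<Rightarrow> quat^'r::{finite,linorder}^'m"
  assumes PD: "\<And>q. P q \<in> D" and proj: "\<And>q y. y \<in> D \<Longrightarrow> (q - P q) \<bullet> (y - P q) \<le> 0"
    and fam: "facially_regular \<F>" "K \<in> \<F>" and "closed K" and D: "D = (+) d ` K"
    and D_nonneg: "\<And>v w. v \<in> D \<Longrightarrow> w \<in> D \<Longrightarrow> 0 \<le> v \<bullet> w"
    and H: "H \<in> mats_over {0..}" and iter: "HNLS_WQ_iterates P M H W"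
  shows "\<exists>Wstar. W \<longlonglongrightarrow> Wstar \<and>
     stationary_point (\<lambda>X. frobenius_sq (M - X ** qmat_of_real H)) (mats_over D) Wstar"
proof -
  define A where "A = H ** transpose H"
  define B where "B i = (\<chi> l. \<Sum>j\<in>UNIV. H $ l $ j *\<^sub>R M $ i $ j)" for i
  have A: "A $ s $ t = H $ s \<bullet> H $ t" for s t
    by (simp add: A_def matrix_matrix_mult_def transpose_def inner_vec_def)
  have B: "B i $ l = (M ** qmat_of_real (transpose H)) $ i $ l" for i l
    by (simp add: B_def matrix_mult_qmat_of_real transpose_def)
  have it: "W (Suc k) $ i $ l = P ((B i $ l - (\<Sum>t | t < l. A $ t $ l *\<^sub>R W (Suc k) $ i $ t)
       - (\<Sum>t | l < t. A $ t $ l *\<^sub>R W k $ i $ t)) /\<^sub>R A $ l $ l)" for k i l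
    using iter unfolding HNLS_WQ_iterates_def Let_def B A_def by blast
  have A0: "0 \<le> A $ s $ t" for s t
    using H by (auto simp: A inner_vec_def mats_over_def intro!: sum_nonneg)
  define limit where "limit i p \<longleftrightarrow> (\<forall>l. p $ l \<in> D) \<and> (\<lambda>k. W k $ i) \<longlonglongrightarrow> p \<and>
     (\<forall>y. (\<forall>l. y $ l \<in> D) \<longrightarrow>
        0 \<le> (\<Sum>l\<in>UNIV. ((\<Sum>t\<in>UNIV. A $ t $ l *\<^sub>R p $ t) - B i $ l) \<bullet> (y $ l - p $ l)))" for i p
  have "\<exists>p. limit i p" for i
    unfolding limit_def
  proof (rule gauss_seidel_converges[where x = "\<lambda>k. W k $ i" and B = "B i",
        OF A _ PD proj fam \<open>closed K\<close> D it A0 D_nonneg])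
    show "B i $ l = 0" if "H $ l = 0" for l using that by (simp add: B_def)
  qed
  then obtain p where limit: "\<And>i. limit i (p i)" by metis
  have p: "p i $ l \<in> D" "(\<lambda>k. W k $ i) \<longlonglongrightarrow> p i" for i l
    using limit[of i] by (simp_all add: limit_def)
  have VI: "0 \<le> (\<Sum>l\<in>UNIV. ((\<Sum>t\<in>UNIV. A $ t $ l *\<^sub>R p i $ t) - B i $ l) \<bullet> (y $ l - p i $ l))"
    if "\<And>l. y $ l \<in> D" for i y
    using limit[of i] that by (simp add: limit_def)
  define Wstar where "Wstar = (\<chi> i. p i)"
  have "W \<longlonglongrightarrow> Wstar" by (rule vec_tendstoI) (simp add: Wstar_def p)
  moreover have "stationary_point (\<lambda>X. frobenius_sq (M - X ** qmat_of_real H)) (mats_over D) Wstar"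
  proof (rule stationary_point_least_squares[OF linear_matrix_mult_left])
    show "Wstar \<in> mats_over D" by (simp add: mats_over_def Wstar_def p)
    fix y :: "quat^'r::{finite,linorder}^'m" assume y: "y \<in> mats_over D"
    have "(Wstar ** qmat_of_real H - M) \<bullet> ((y - Wstar) ** qmat_of_real H)
      = (\<Sum>i\<in>UNIV. \<Sum>l\<in>UNIV. ((\<Sum>t\<in>UNIV. A $ t $ l *\<^sub>R p i $ t) - B i $ l) \<bullet> (y $ i $ l - p i $ l))"
      by (simp add: inner_vec_def[where 'a = "quat^'n"] inner_vec_def[where 'a = quat]
          matrix_mult_qmat_of_real Wstar_def A B_def residual_inner_row)
    also have "\<dots> \<ge> 0" using y by (intro sum_nonneg VI) (simp add: mats_over_def)
    finally show "0 \<le> (Wstar ** qmat_of_real H - M) \<bullet> ((y - Wstar) ** qmat_of_real H)" .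
  qed
  ultimately show ?thesis by blast
qed

lemma HNLS_HR_converges:
  fixes M :: "quat^'n^'m" and W :: "quat^'r::{finite,linorder}^'m"
    and H :: "nat \<Rightarrow> real^'n^'r::{finite,linorder}"
  assumes "\<xi> > 0" and W: "W \<in> mats_over Hc"
    and nonneg: "\<And>v w. v \<in> Hc \<Longrightarrow> w \<in> Hc \<Longrightarrow> 0 \<le> v \<bullet> w"
    and iter: "HNLS_HR_iterates \<xi> M W H"
  shows "\<exists>Hstar. H \<longlonglongrightarrow> Hstar \<and>
     stationary_point (\<lambda>Y. frobenius_sq (M - W ** qmat_of_real Y)) (mats_over {\<xi>..}) Hstar"
proof -
  \<comment> \<open>The Gram vectors are the columns of \<open>W\<close>, because the real part of
    \<open>qcnj p * q\<close> is the inner product \<open>p \<bullet> q\<close>.\<close>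
  define u where "u l = (\<chi> i. W $ i $ l)" for l
  define A where "A = qmat_Re (qmat_adjoint W ** W)"
  define B where "B j = (\<chi> l. \<Sum>i\<in>UNIV. W $ i $ l \<bullet> M $ i $ j)" for j
  have qre_sum: "qre (sum f S) = (\<Sum>i\<in>S. qre (f i))" for f :: "'m \<Rightarrow> quat" and S
    by (induction S rule: infinite_finite_induct) (simp_all add: zero_quat_def plus_quat_def)
  have qre_cnj: "qre (qcnj p * q) = p \<bullet> q" for p q
    by (simp add: qcnj_def times_quat_def inner_quat_def)
  have A: "A $ s $ t = u s \<bullet> u t" for s t
    by (simp add: A_def u_def qmat_Re_def qmat_adjoint_def matrix_matrix_mult_def inner_vec_def qre_sum qre_cnj)
  have B: "B j $ l = qmat_Re (qmat_adjoint W ** M) $ l $ j" for j l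
    by (simp add: B_def qmat_Re_def qmat_adjoint_def matrix_matrix_mult_def qre_sum qre_cnj)
  have it0: "H (Suc k) $ l $ j = max \<xi> ((B j $ l - (\<Sum>t | t < l. A $ l $ t * H (Suc k) $ t $ j)
       - (\<Sum>t | l < t. A $ l $ t * H k $ t $ j)) / A $ l $ l)" for k l j
    using iter unfolding HNLS_HR_iterates_def Let_def B A_def by blast
  have it: "(\<chi> t. H (Suc k) $ t $ j) $ l = max \<xi> ((B j $ l
       - (\<Sum>t | t < l. A $ t $ l *\<^sub>R (\<chi> t. H (Suc k) $ t $ j) $ t)
       - (\<Sum>t | l < t. A $ t $ l *\<^sub>R (\<chi> t. H k $ t $ j) $ t)) /\<^sub>R A $ l $ l)" for k l j
    using it0[of k l j] by (simp add: A inner_commute divide_inverse_commute)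
  have A0: "0 \<le> A $ s $ t" for s t
    using W nonneg by (auto simp: A u_def inner_vec_def mats_over_def intro!: sum_nonneg)
  define limit where "limit j p \<longleftrightarrow> (\<forall>l. p $ l \<in> {\<xi>..}) \<and> (\<lambda>k. \<chi> t. H k $ t $ j) \<longlonglongrightarrow> p \<and>
     (\<forall>y. (\<forall>l. y $ l \<in> {\<xi>..}) \<longrightarrow>
        0 \<le> (\<Sum>l\<in>UNIV. ((\<Sum>t\<in>UNIV. A $ t $ l *\<^sub>R p $ t) - B j $ l) \<bullet> (y $ l - p $ l)))" for j p
  have "\<exists>p. limit j p" for j
    unfolding limit_def
  proof (rule gauss_seidel_converges[where x = "\<lambda>k. \<chi> t. H k $ t $ j" and B = "B j" and P = "max \<xi>",
        OF A _ _ _ facially_regular_coordinate_cones rangeI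
        closed_coordinate_cone atLeast_eq_translate it A0])
    show "B j $ l = 0" if "u l = 0" for l
      using that by (simp add: B_def u_def vec_eq_iff)
    show "(q - max \<xi> q) \<bullet> (y - max \<xi> q) \<le> 0" if "y \<in> {\<xi>..}" for q y
      using that by (auto simp: max_def mult_le_0_iff)
  qed (use \<open>\<xi> > 0\<close> in auto)
  then obtain p where limit: "\<And>j. limit j (p j)" by metis
  have p: "p j $ l \<in> {\<xi>..}" "(\<lambda>k. \<chi> t. H k $ t $ j) \<longlonglongrightarrow> p j" for j l
    using limit[of j] unfolding limit_def by blast+
  have VI: "0 \<le> (\<Sum>l\<in>UNIV. ((\<Sum>t\<in>UNIV. A $ t $ l *\<^sub>R p j $ t) - B j $ l) \<bullet> (y $ l - p j $ l))"
    if "\<And>l. y $ l \<in> {\<xi>..}" for j y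
    using limit[of j] that unfolding limit_def by blast
  define Hstar where "Hstar = (\<chi> l j. p j $ l)"
  have "H \<longlonglongrightarrow> Hstar"
  proof (intro vec_tendstoI)
    fix l j
    show "(\<lambda>k. H k $ l $ j) \<longlonglongrightarrow> Hstar $ l $ j"
      using tendsto_vec_nth[OF p(2)[of j], of l] by (simp add: Hstar_def)
  qed
  moreover have "stationary_point (\<lambda>Y. frobenius_sq (M - W ** qmat_of_real Y)) (mats_over {\<xi>..}) Hstar"
  proof (rule stationary_point_least_squares[OF linear_matrix_mult_right])
    show "Hstar \<in> mats_over {\<xi>..}" using p(1) by (simp add: mats_over_def Hstar_def)
    fix y :: "real^'n^'r::{finite,linorder}" assume y: "y \<in> mats_over {\<xi>..}"
    have "(W ** qmat_of_real Hstar - M) \<bullet> (W ** qmat_of_real (y - Hstar))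
      = (\<Sum>j\<in>UNIV. \<Sum>i\<in>UNIV. (W ** qmat_of_real Hstar - M) $ i $ j \<bullet> (W ** qmat_of_real (y - Hstar)) $ i $ j)"
      unfolding inner_vec_def by (rule sum.swap)
    also have "\<dots> = (\<Sum>j\<in>UNIV. \<Sum>l\<in>UNIV. ((\<Sum>t\<in>UNIV. A $ t $ l *\<^sub>R p j $ t) - B j $ l) \<bullet> (y $ l $ j - p j $ l))"
      by (simp add: matrix_mult_qmat_of_real Hstar_def A u_def inner_vec_def B_def residual_inner_column)
    also have "\<dots> \<ge> 0"
    proof (rule sum_nonneg)
      fix j
      show "0 \<le> (\<Sum>l\<in>UNIV. ((\<Sum>t\<in>UNIV. A $ t $ l *\<^sub>R p j $ t) - B j $ l) \<bullet> (y $ l $ j - p j $ l))"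
        using VI[of "\<chi> l. y $ l $ j" j] y by (simp add: mats_over_def)
    qed
    finally show "0 \<le> (W ** qmat_of_real Hstar - M) \<bullet> (W ** qmat_of_real (y - Hstar))" .
  qed
  ultimately show ?thesis by blast
qed

theorem theorem1:
  fixes M :: "quat^'n^'m" and \<xi> :: real
    and Hc D :: "quat set" and P :: "quat \<Rightarrow> quat"
  assumes "\<xi> > 0"
    and "(Hc = H_S \<and> D = H_S \<and> P = proj_S) \<or>
         (Hc = H_pure \<and> D = H_pure_floor \<xi> \<and> P = proj_pure \<xi>)"
    and "M \<in> mats_over Hc"
  shows
    "(\<forall>(H :: real^'n^'r::{finite,linorder})
         (W :: nat \<Rightarrow> quat^'r::{finite,linorder}^'m).
        H \<in> mats_over {0..} \<longrightarrow> W 0 \<in> mats_over Hc \<longrightarrow> HNLS_WQ_iterates P M H W \<longrightarrow>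
        (\<exists>Wstar. W \<longlonglongrightarrow> Wstar \<and>
           stationary_point (\<lambda>X. frobenius_sq (M - X ** qmat_of_real H)) (mats_over D) Wstar)) \<and>
     (\<forall>(W :: quat^'r::{finite,linorder}^'m)
         (H :: nat \<Rightarrow> real^'n^'r::{finite,linorder}).
        W \<in> mats_over Hc \<longrightarrow> H 0 \<in> mats_over {0..} \<longrightarrow> HNLS_HR_iterates \<xi> M W H \<longrightarrow>
        (\<exists>Hstar. H \<longlonglongrightarrow> Hstar \<and>
           stationary_point (\<lambda>Y. frobenius_sq (M - W ** qmat_of_real Y)) (mats_over {\<xi>..}) Hstar))"
proof -
  have pure_nonneg: "0 \<le> v \<bullet> w" if "v \<in> H_pure" "w \<in> H_pure" for v w
    using that by (simp add: H_pure_def inner_quat_def)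
  have Hc_nonneg: "0 \<le> v \<bullet> w" if "v \<in> Hc" "w \<in> Hc" for v w
    using assms(2) that H_S_inner_nonneg pure_nonneg by blast
  have "\<exists>Wstar. W \<longlonglongrightarrow> Wstar \<and>
           stationary_point (\<lambda>X. frobenius_sq (M - X ** qmat_of_real H)) (mats_over D) Wstar"
    if H: "H \<in> mats_over {0..}" and iter: "HNLS_WQ_iterates P M H W"
    for H :: "real^'n^'r::{finite,linorder}" and W :: "nat \<Rightarrow> quat^'r::{finite,linorder}^'m"
    using assms(2)
  proof (elim disjE conjE)
    assume D: "D = H_S" and P: "P = proj_S"
    show ?thesis unfolding D
    proof (rule HNLS_WQ_converges[OF proj_S_in proj_S_obtuse
          facially_regular_second_order_cone[OF norm_one_quat] insertI1 closed_second_order_cone])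
      show "H_S = (+) 0 ` second_order_cone 1" by (simp add: H_S_eq_second_order_cone)
    qed (use H iter P H_S_inner_nonneg in auto)
  next
    assume D: "D = H_pure_floor \<xi>" and P: "P = proj_pure \<xi>"
    \<comment> \<open>The floor set is not a cone: nonnegative pairing is inherited from
      \<open>H_pure\<close> by inclusion, the error bound by translation.\<close>
    have "H_pure_floor \<xi> \<subseteq> H_pure" using \<open>\<xi> > 0\<close> by (auto simp: H_pure_floor_def H_pure_def)
    then show ?thesis unfolding D
      using H iter P pure_nonneg
      by (intro HNLS_WQ_converges[OF proj_pure_in proj_pure_obtuse[OF \<open>\<xi> > 0\<close>]
          facially_regular_coordinate_cones rangeI closed_coordinate_cone
          H_pure_floor_eq_translate[unfolded H_pure_eq_coordinate_cone]]) auto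
  qed
  moreover have "\<exists>Hstar. H \<longlonglongrightarrow> Hstar \<and>
           stationary_point (\<lambda>Y. frobenius_sq (M - W ** qmat_of_real Y)) (mats_over {\<xi>..}) Hstar"
    if "W \<in> mats_over Hc" "HNLS_HR_iterates \<xi> M W H"
    for W :: "quat^'r::{finite,linorder}^'m" and H :: "nat \<Rightarrow> real^'n^'r::{finite,linorder}"
    using HNLS_HR_converges[OF \<open>\<xi> > 0\<close> that(1) Hc_nonneg that(2)] .
  ultimately show ?thesis by blast
qed

end
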